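(* If $f\in\mathcal F_{\mathrm{FSSA}}$, then $$\inf_{g\in\mathcal M}\mathrm{KL}(f\|g)=0\iff\int_{\mathbb{R}^d}\|x\|^2f(x)\,\mathrm{d}x<\infty.$$
   Context: Densities are w.r.t. Lebesgue measure; $F(A)=\int_Af\,\mathrm{d}x$; $\operatorname{supp}(f)=\{x:f(x)>0\}$. Comparison cubes are closed axis-aligned cubes; partition cubes may be half-open so as to be disjoint. "A cube of side $r$ with a vertex at $y$" means a closed axis-aligned cube of side length $r$ having $y$ as one of its vertices. A family of cubes of common side length is adjacent if they have pairwise disjoint interiors and the union of their closures is connected. Definition ($\mathcal F_{\mathrm{FSSA}}$): a density $f$ on $\mathbb{R}^d$ belongs to $\mathcal F_{\mathrm{FSSA}}$ if there exist, for each $m\ge1$, a partition $\operatorname{supp}(f)=A^{(m)}_0\sqcup A^{(m)}_1\sqcup\cdots\sqcup A^{(m)}_m$ in which $A^{(m)}_1,\dots,A^{(m)}_m$ are adjacent cubes of common side length $h_m>0$ and $A^{(m)}_0$ is the remainder, such that: (i) $f$ is continuous on $\operatorname{supp}(f)$ except on a set of $F$-measure zero; (ii) there exist $r>0$ and, for every $y\in\operatorname{supp}(f)$, a comparison cube $C(r,y)$ of side length $r$ containing $y$, such that $D_r(y)=\log\big(f(y)/\inf_{z\in C(r,y)}f(z)\big)$ is measurable on $\operatorname{supp}(f)$ and $\int_{\operatorname{supp}(f)}D_r\,\mathrm{d}F<\infty$; (iii) there exists $M\in\mathbb N$ such that for every $m\ge M$: (a) if $y\in A^{(m)}_0$ then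 $C(r,y)\cap A^{(m)}_0$ contains a cube of side $r/2$ with a vertex at $y$; (b) if $y\in\operatorname{supp}(f)\setminus A^{(m)}_0$ then $C(r,y)\cap(\operatorname{supp}(f)\setminus A^{(m)}_0)$ contains a cube of side $r/2$ with a vertex at $y$. $\mathrm{KL}(f\|g)=\int f\log(f/g)\,\mathrm{d}x\in[0,\infty]$. $\mathcal M$ denotes the class of all finite Gaussian mixture densities on $\mathbb{R}^d$: $x\mapsto\sum_{j=1}^m\pi_j\varphi(x;\mu_j,\Sigma_j)$ with $m\in\mathbb N$, $\pi_j\ge0$, $\sum_j\pi_j=1$, $\mu_j\in\mathbb{R}^d$, $\Sigma_j\succ0$, $\varphi(\cdot;\mu,\Sigma)$ the $N(\mu,\Sigma)$ density. *)

theory Defs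
  imports "HOL-Analysis.Analysis"
begin

definition is_density :: "(real^'n \<Rightarrow> real) \<Rightarrow> bool" where
  "is_density f \<longleftrightarrow> f \<in> borel_measurable lebesgue \<and> (\<forall>x. 0 \<le> f x)
     \<and> (\<integral>\<^sup>+ x. ennreal (f x) \<partial>lebesgue) = 1"

definition fsupp :: "(real^'n \<Rightarrow> real) \<Rightarrow> (real^'n) set" where
  "fsupp f = {x. f x > 0}"

definition Fmeas :: "(real^'n \<Rightarrow> real) \<Rightarrow> (real^'n) measure" where
  "Fmeas f = density lebesgue (\<lambda>x. ennreal (f x))"

definition closed_cube :: "real \<Rightarrow> (real^'n) set \<Rightarrow> bool" where
  "closed_cube s Q \<longleftrightarrow> (\<exists>a. Q = cbox a (a + s *\<^sub>R One))"

definition cube_with_vertex :: "real \<Rightarrow> real^'n \<Rightarrow> (real^'n) set \<Rightarrow> bool" where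
  "cube_with_vertex s y Q \<longleftrightarrow>
     (\<exists>a. Q = cbox a (a + s *\<^sub>R One) \<and> (\<forall>i. y $ i = a $ i \<or> y $ i = a $ i + s))"

text \<open>Partition cube of side h: possibly half-open, i.e. lies between the open and the
  closed axis-aligned cube with the same corners.\<close>
definition part_cube :: "real \<Rightarrow> (real^'n) set \<Rightarrow> bool" where
  "part_cube h Q \<longleftrightarrow> (\<exists>a. box a (a + h *\<^sub>R One) \<subseteq> Q \<and> Q \<subseteq> cbox a (a + h *\<^sub>R One))"

definition Dr :: "(real^'n \<Rightarrow> real) \<Rightarrow> (real^'n \<Rightarrow> (real^'n) set) \<Rightarrow> real^'n \<Rightarrow> ennreal" where
  "Dr f C y = (let i = Inf (f ` C y) in if i \<le> 0 then \<infinity> else ennreal (ln (f y / i)))"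

definition FSSA :: "(real^'n \<Rightarrow> real) \<Rightarrow> bool" where
  "FSSA f \<longleftrightarrow> is_density f \<and>
   (\<exists>(A :: nat \<Rightarrow> nat \<Rightarrow> (real^'n) set) (h :: nat \<Rightarrow> real) (r :: real) (C :: real^'n \<Rightarrow> (real^'n) set).
     \<comment> \<open>partitions\<close>
     (\<forall>m\<ge>1. h m > 0
        \<and> fsupp f = (\<Union>j\<le>m. A m j)
        \<and> (\<forall>i\<le>m. \<forall>j\<le>m. i \<noteq> j \<longrightarrow> A m i \<inter> A m j = {})
        \<and> (\<forall>j\<in>{1..m}. part_cube (h m) (A m j))
        \<and> (\<forall>i\<in>{1..m}. \<forall>j\<in>{1..m}. i \<noteq> j \<longrightarrow> interior (A m i) \<inter> interior (A m j) = {})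
        \<and> connected (\<Union>j\<in>{1..m}. closure (A m j)))
     \<comment> \<open>(i)\<close>
     \<and> (\<exists>N \<in> null_sets (Fmeas f). \<forall>x \<in> fsupp f - N. continuous (at x within fsupp f) f)
     \<comment> \<open>(ii)\<close>
     \<and> r > 0
     \<and> (\<forall>y\<in>fsupp f. closed_cube r (C y) \<and> y \<in> C y)
     \<and> Dr f C \<in> borel_measurable (restrict_space lebesgue (fsupp f))
     \<and> (\<integral>\<^sup>+ y \<in> fsupp f. Dr f C y \<partial>Fmeas f) < \<infinity>
     \<comment> \<open>(iii)\<close>
     \<and> (\<exists>M::nat. M \<ge> 1 \<and> (\<forall>m\<ge>M.
          (\<forall>y\<in>A m 0. \<exists>Q. cube_with_vertex (r/2) y Q \<and> Q \<subseteq> C y \<inter> A m 0)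
        \<and> (\<forall>y\<in>fsupp f - A m 0. \<exists>Q. cube_with_vertex (r/2) y Q \<and> Q \<subseteq> C y \<inter> (fsupp f - A m 0)))))"

text \<open>Kullback-Leibler divergence, as an extended real: integral of f log(f/g)
  with conventions 0 log(0/g) = 0 and f log(f/0) = \<infinity> for f > 0.\<close>
definition KL :: "(real^'n \<Rightarrow> real) \<Rightarrow> (real^'n \<Rightarrow> real) \<Rightarrow> ereal" where
  "KL f g =
     enn2ereal (\<integral>\<^sup>+ x. (if f x > 0 \<and> g x \<le> 0 then \<infinity>
                        else ennreal (max 0 (f x * ln (f x / g x)))) \<partial>lebesgue)
   - enn2ereal (\<integral>\<^sup>+ x. (if f x > 0 \<and> g x \<le> 0 then 0
                        else ennreal (max 0 (- (f x * ln (f x / g x))))) \<partial>lebesgue)"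

definition pos_def_mat :: "real^'n^'n \<Rightarrow> bool" where
  "pos_def_mat S \<longleftrightarrow> transpose S = S \<and> (\<forall>x. x \<noteq> 0 \<longrightarrow> x \<bullet> (S *v x) > 0)"

definition gauss :: "real^'n \<Rightarrow> real^'n^'n \<Rightarrow> real^'n \<Rightarrow> real" where
  "gauss mu S x = exp (- (1/2) * ((x - mu) \<bullet> (matrix_inv S *v (x - mu))))
                   / sqrt ((2 * pi) ^ CARD('n) * det S)"

definition GMM :: "(real^'n \<Rightarrow> real) set" where
  "GMM = {g. \<exists>(m::nat) (p :: nat \<Rightarrow> real) (mu :: nat \<Rightarrow> real^'n) (S :: nat \<Rightarrow> real^'n^'n).
            m \<ge> 1 \<and> (\<forall>j<m. p j \<ge> 0) \<and> (\<Sum>j<m. p j) = 1 \<and> (\<forall>j<m. pos_def_mat (S j))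
            \<and> g = (\<lambda>x. \<Sum>j<m. p j * gauss (mu j) (S j) x)}"

end

(* If KL(f||g) is finite for one Gaussian mixture g, compare f log(f/g) with f log(f/q) for a wider
   Gaussian q: since g <= K exp(-c |x|^2), the difference f log(q/g) controls |x|^2 f, while
   f log(f/q) >= f - q.

   Conversely, the comparison cubes give an integrable f max(0, log f), because the infimum of f over
   a cube of side r is at most r^(-n).  With a finite second moment, the positive part of
   f log(f / ((1-d) g + d N)), N the standard Gaussian, is then dominated independently of g >= 0, so
   its integral is continuous under almost everywhere convergence of g.  The closure of the mixtures
   under such limits contains convolutions v * N(0, s^2 I) (replace the centre by simple functions),
   hence continuous bounded densities v (s -> 0), hence f itself; and g = f gives at most -log(1-d).

   The Gibbs inequality KL >= 0 needs general Gaussian densities to have integral 1, which comes from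
   a Gram-Schmidt basis for the covariance form and a linear change of variables. *)
theory Submission
  imports Defs "HOL-Probability.Distributions"
begin

section \<open>Linear change of variables\<close>

text \<open>\<open>lborel\<close> is determined by its values on boxes, and swapping two coordinates
  only permutes the factors in the volume of a box.\<close>

lemma nn_integral_lborel_swap:
  fixes h :: "real^'n \<Rightarrow> ennreal"
  assumes [measurable]: "h \<in> borel_measurable borel" and "m \<noteq> n"
  shows "(\<integral>\<^sup>+x. h (\<chi> i. x $ Transposition.transpose m n i) \<partial>lborel) = (\<integral>\<^sup>+x. h x \<partial>lborel)"
proof -
  let ?T = "\<lambda>x::real^'n. \<chi> i. x $ Transposition.transpose m n i"
  have [measurable]: "?T \<in> borel_measurable borel"
    by (intro borel_measurable_continuous_onI continuous_intros)
  have "lborel = distr lborel borel ?T"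
  proof (rule lborel_eqI)
    fix l u :: "real^'n" assume le: "\<And>b. b \<in> Basis \<Longrightarrow> l \<bullet> b \<le> u \<bullet> b"
    have le': "l $ i \<le> u $ i" for i
      using le[of "axis i 1"] by (simp add: inner_axis)
    have eq: "?T -` box l u = box (?T l) (?T u)"
      by (auto simp: mem_box_cart) (metis transpose_involutory)+
    have pB: "(\<Prod>b\<in>Basis. (y - x) \<bullet> b) = (\<Prod>i\<in>UNIV. y $ i - x $ i)" for x y :: "real^'n"
    proof -
      have "Basis = range (\<lambda>i::'n. axis i (1::real))"
        by (auto simp: Basis_vec_def)
      then show ?thesis
        using prod.reindex[of "\<lambda>i::'n. axis i (1::real)" UNIV "\<lambda>b. (y - x) \<bullet> b"]
        by (simp add: inj_on_def axis_eq_axis inner_axis)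
    qed
    have "emeasure (distr lborel borel ?T) (box l u) = emeasure lborel (box (?T l) (?T u))"
      by (simp add: emeasure_distr eq)
    also have "\<dots> = (\<Prod>b\<in>Basis. (?T u - ?T l) \<bullet> b)"
      using le' by (subst emeasure_lborel_box) (auto simp: Basis_vec_def inner_axis)
    also have "(\<Prod>b\<in>Basis. (?T u - ?T l) \<bullet> b) = (\<Prod>b\<in>Basis. (u - l) \<bullet> b)"
      using prod.permute [OF permutes_swap_id, where S=UNIV and g="\<lambda>i. u $ i - l $ i", of m n]
      by (simp add: pB o_def)
    finally show "emeasure (distr lborel borel ?T) (box l u) = (\<Prod>b\<in>Basis. (u - l) \<bullet> b)" .
  qed simp
  then have "(\<integral>\<^sup>+x. h x \<partial>lborel) = (\<integral>\<^sup>+x. h x \<partial>distr lborel borel ?T)"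
    by simp
  also have "\<dots> = (\<integral>\<^sup>+x. h (?T x) \<partial>lborel)"
    by (rule nn_integral_distr) auto
  finally show ?thesis ..
qed

text \<open>Fubini with coordinate \<open>m\<close> innermost: once the other coordinates are fixed,
  the shear is a translation of the line by the constant \<open>x$n\<close>, and one-dimensional
  Lebesgue measure is translation invariant.\<close>

lemma nn_integral_lborel_shear:
  fixes h :: "real^'n \<Rightarrow> ennreal"
  assumes [measurable]: "h \<in> borel_measurable borel" and "m \<noteq> n"
  shows "(\<integral>\<^sup>+x. h (\<chi> i. if i = m then x$m + x$n else x$i) \<partial>lborel) = (\<integral>\<^sup>+x. h x \<partial>lborel)"
proof -
  let ?T = "\<lambda>x::real^'n. \<chi> i. if i = m then x$m + x$n else x$i"
  let ?m = "axis m (1::real)" let ?I = "Basis - {?m}"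
  let ?V = "\<lambda>f. \<Sum>b\<in>Basis. f b *\<^sub>R (b::real^'n)"
  interpret product_sigma_finite "\<lambda>_::real^'n. lborel :: real measure"
    by standard
  have [measurable]: "?T \<in> borel_measurable borel"
  proof (rule borel_measurable_continuous_onI, rule continuous_on_vec_lambda)
    show "continuous_on UNIV (\<lambda>x::real^'n. if i = m then x$m + x$n else x$i)" for i
      by (cases "i = m") (auto intro!: continuous_intros)
  qed
  have B: "Basis = insert ?m ?I" and mI: "?m \<notin> ?I" "finite ?I"
    by auto
  have [measurable]: "?V \<in> measurable (PiM Basis (\<lambda>_. lborel)) borel"
    by measurable
  have nth: "?V f $ i = f (axis i 1)" for f i
  proof -
    have "?V f $ i = ?V f \<bullet> axis i 1" by (simp add: inner_axis)
    also have "\<dots> = f (axis i 1)" by (rule inner_sum_left_Basis) auto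
    finally show ?thesis .
  qed
  \<comment> \<open>In coordinates the shear moves only entry \<open>m\<close>. The shift
    \<open>f (axis n 1)\<close> does not involve \<open>y\<close> because \<open>m\<close> and
    \<open>n\<close> differ.\<close>
  have TV: "?T (?V (f(?m := y))) = ?V (f(?m := y + f (axis n 1)))" for f y
  proof (subst vec_eq_iff, intro allI)
    fix i show "?T (?V (f(?m := y))) $ i = ?V (f(?m := y + f (axis n 1))) $ i"
      using \<open>m \<noteq> n\<close> unfolding vec_lambda_beta nth by (simp add: axis_eq_axis)
  qed
  have I: "(\<integral>\<^sup>+x. k x \<partial>lborel)
      = (\<integral>\<^sup>+f. (\<integral>\<^sup>+y. k (?V (f(?m := y))) \<partial>lborel) \<partial>PiM ?I (\<lambda>_. lborel))"
    if [measurable]: "k \<in> borel_measurable borel" for k :: "real^'n \<Rightarrow> ennreal"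
  proof -
    have "(\<integral>\<^sup>+x. k x \<partial>lborel) = (\<integral>\<^sup>+f. k (?V f) \<partial>PiM Basis (\<lambda>_. lborel))"
      by (subst lborel_eq, subst nn_integral_distr) auto
    also have "\<dots> = (\<integral>\<^sup>+f. k (?V f) \<partial>PiM (insert ?m ?I) (\<lambda>_. lborel))"
      using B by simp
    also have "\<dots> = (\<integral>\<^sup>+f. (\<integral>\<^sup>+y. k (?V (f(?m := y))) \<partial>lborel) \<partial>PiM ?I (\<lambda>_. lborel))"
      by (rule product_nn_integral_insert[OF mI(2,1)]) (subst B[symmetric], measurable)
    finally show ?thesis .
  qed
  have mV: "(\<lambda>y. h (?V (f(?m := y)))) \<in> borel_measurable borel" if "f \<in> space (PiM ?I (\<lambda>_. lborel))" for f
  proof -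
    have "continuous_on UNIV (\<lambda>y. (f(?m := y)) b)" for b
      by (cases "b = ?m") auto
    then have "(\<lambda>y. ?V (f(?m := y))) \<in> borel_measurable borel"
      by (intro borel_measurable_continuous_onI continuous_intros)
    then show ?thesis by measurable
  qed
  have "(\<integral>\<^sup>+x. h (?T x) \<partial>lborel)
    = (\<integral>\<^sup>+f. (\<integral>\<^sup>+y. h (?V (f(?m := y + f (axis n 1)))) \<partial>lborel) \<partial>PiM ?I (\<lambda>_. lborel))"
    by (subst I) (simp_all add: TV)
  also have "\<dots> = (\<integral>\<^sup>+f. (\<integral>\<^sup>+y. h (?V (f(?m := y))) \<partial>lborel) \<partial>PiM ?I (\<lambda>_. lborel))"
  proof (rule nn_integral_cong)
    fix f assume f: "f \<in> space (PiM ?I (\<lambda>_. lborel :: real measure))"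
    show "(\<integral>\<^sup>+y. h (?V (f(?m := y + f (axis n 1)))) \<partial>lborel) = (\<integral>\<^sup>+y. h (?V (f(?m := y))) \<partial>lborel)"
      using nn_integral_real_affine[OF mV[OF f], of 1 "f (axis n 1)"] by (simp add: add.commute)
  qed
  also have "\<dots> = (\<integral>\<^sup>+x. h x \<partial>lborel)"
    by (rule I[symmetric]) fact
  finally show ?thesis .
qed

lemma nn_integral_lborel_stretch:
  fixes h :: "real^'n \<Rightarrow> ennreal"
  assumes [measurable]: "h \<in> borel_measurable borel" and c: "\<And>i. c i \<noteq> 0"
  shows "ennreal \<bar>\<Prod>i\<in>UNIV. c i\<bar> * (\<integral>\<^sup>+x. h (\<chi> i. c i * x $ i) \<partial>lborel) = (\<integral>\<^sup>+x. h x \<partial>lborel)"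
proof -
  \<comment> \<open>\<open>?c\<close> turns the factors \<open>c\<close>, indexed by
    \<open>'n\<close>, into a function on basis vectors with \<open>?c (axis i 1) = c i\<close>, the
    form that \<open>lborel_affine_euclidean\<close> expects.\<close>
  let ?c = "\<lambda>b::real^'n. \<Sum>i\<in>UNIV. c i * b $ i"
  let ?T = "\<lambda>x::real^'n. \<chi> i. c i * x $ i"
  have ax: "?c (axis i 1) = c i" for i
    by (simp add: axis_def if_distrib cong: if_cong)
  have R: "Basis = range (\<lambda>i::'n. axis i (1::real))" and inj: "inj (\<lambda>i::'n. axis i (1::real))"
    by (auto simp: Basis_vec_def inj_on_def axis_eq_axis)
  have T: "0 + (\<Sum>j\<in>Basis. (?c j * (x \<bullet> j)) *\<^sub>R j) = ?T x" for x
    unfolding R by (simp add: sum.reindex[OF inj] ax inner_axis vec_eq_iff)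
      (simp add: axis_def if_distrib cong: if_cong)
  have [measurable]: "?T \<in> borel_measurable borel"
    by (intro borel_measurable_continuous_onI continuous_intros)
  have "lborel = density (distr lborel borel ?T) (\<lambda>_. (\<Prod>j\<in>Basis. \<bar>?c j\<bar>))"
    unfolding T[symmetric] by (rule lborel_affine_euclidean) (use c in \<open>auto simp: R ax\<close>)
  also have "(\<Prod>j\<in>Basis. \<bar>?c j\<bar>) = \<bar>\<Prod>i\<in>UNIV. c i\<bar>"
    unfolding R by (simp add: prod.reindex[OF inj] ax abs_prod)
  finally have "(\<integral>\<^sup>+x. h x \<partial>lborel)
     = (\<integral>\<^sup>+x. h x \<partial>density (distr lborel borel ?T) (\<lambda>_. ennreal \<bar>\<Prod>i\<in>UNIV. c i\<bar>))"
    by simp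
  also have "\<dots> = ennreal \<bar>\<Prod>i\<in>UNIV. c i\<bar> * (\<integral>\<^sup>+x. h (?T x) \<partial>lborel)"
    by (simp add: nn_integral_density nn_integral_distr nn_integral_cmult)
  finally show ?thesis ..
qed

text \<open>The library states this only for index types of class \<open>wellorder\<close>.\<close>
lemma nn_integral_lborel_linear:
  fixes f :: "real^'n \<Rightarrow> real^'n" and h :: "real^'n \<Rightarrow> ennreal"
  assumes "linear f" "det (matrix f) \<noteq> 0" "h \<in> borel_measurable borel"
  shows "ennreal \<bar>det (matrix f)\<bar> * (\<integral>\<^sup>+x. h (f x) \<partial>lborel) = (\<integral>\<^sup>+x. h x \<partial>lborel)"
proof -
  let ?P = "\<lambda>f::real^'n \<Rightarrow> real^'n. det (matrix f) \<noteq> 0 \<longrightarrow> (\<forall>h\<in>borel_measurable borel.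
      ennreal \<bar>det (matrix f)\<bar> * (\<integral>\<^sup>+x. h (f x) \<partial>lborel) = (\<integral>\<^sup>+x. h x \<partial>lborel))"
  \<comment> \<open>Every linear map is built from elementary ones. The formula composes because
    \<open>det\<close> is multiplicative, and the guard in \<open>?P\<close> makes the case of a
    zero row vacuous and all stretching factors nonzero.\<close>
  have "?P f"
  proof (rule induct_linear_elementary[OF \<open>linear f\<close>])
    fix f g :: "real^'n \<Rightarrow> real^'n"
    assume lin: "linear f" "linear g" and Pf: "?P f" and Pg: "?P g"
    have d: "det (matrix (f \<circ> g)) = det (matrix f) * det (matrix g)"
      using lin by (simp add: matrix_compose det_mul)
    show "?P (f \<circ> g)"
    proof (intro impI ballI)
      fix h :: "real^'n \<Rightarrow> ennreal" assume [measurable]: "h \<in> borel_measurable borel"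
      assume nz: "det (matrix (f \<circ> g)) \<noteq> 0"
      have [measurable]: "f \<in> borel_measurable borel"
        using lin by (intro borel_measurable_continuous_onI linear_continuous_on linear_conv_bounded_linear[THEN iffD1])
      have "(\<integral>\<^sup>+x. h x \<partial>lborel) = ennreal \<bar>det (matrix f)\<bar> * (\<integral>\<^sup>+x. h (f x) \<partial>lborel)"
        using Pf nz d by auto
      also have "(\<integral>\<^sup>+x. h (f x) \<partial>lborel) = ennreal \<bar>det (matrix g)\<bar> * (\<integral>\<^sup>+x. h (f (g x)) \<partial>lborel)"
        using Pg[rule_format, of "\<lambda>x. h (f x)"] nz d by auto
      finally show "ennreal \<bar>det (matrix (f \<circ> g))\<bar> * (\<integral>\<^sup>+x. h ((f \<circ> g) x) \<partial>lborel) = (\<integral>\<^sup>+x. h x \<partial>lborel)"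
        by (simp add: d abs_mult ennreal_mult mult.assoc)
    qed
  next
    fix f :: "real^'n \<Rightarrow> real^'n" and i
    assume lin: "linear f" and 0: "\<And>x. f x $ i = 0"
    have "det (matrix f) = 0"
      by (rule det_zero_row(1)[of i]) (simp add: row_def matrix_def 0 vec_eq_iff)
    then show "?P f" by simp
  next
    fix c :: "'n \<Rightarrow> real"
    have d: "det (matrix (\<lambda>x. \<chi> i. c i * x $ i)) = prod c UNIV"
      by (subst det_diagonal) (auto simp: matrix_def axis_def)
    show "?P (\<lambda>x. \<chi> i. c i * x $ i)"
      unfolding d by (auto intro!: nn_integral_lborel_stretch)
  next
    fix m n :: 'n assume "m \<noteq> n"
    let ?h = "\<lambda>v::real^'n. \<chi> i. v $ Transposition.transpose m n i"
    have "matrix ?h = (\<chi> i. mat 1 $ Transposition.transpose m n i)"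
      by (simp add: matrix_def axis_def mat_def vec_eq_iff)
    then have "\<bar>det (matrix ?h)\<bar> = 1"
      by (simp add: det_permute_rows permutes_swap_id sign_swap_id abs_mult)
    then show "?P ?h"
      using nn_integral_lborel_swap[OF _ \<open>m \<noteq> n\<close>] by auto
  next
    fix m n :: 'n assume "m \<noteq> n"
    let ?h = "\<lambda>x::real^'n. \<chi> i. if i = m then x$m + x$n else x$i"
    have "matrix ?h = (\<chi> k. if k = m then row m (mat 1) + 1 *s row n (mat 1) else row k (mat 1))"
      by (auto simp: matrix_def axis_def row_def mat_def vec_eq_iff)
    then have "det (matrix ?h) = 1"
      using det_row_operation[OF \<open>m \<noteq> n\<close>, of "mat 1 :: real^'n^'n" 1] by simp
    then show "?P ?h"
      using nn_integral_lborel_shear[OF _ \<open>m \<noteq> n\<close>] by auto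
  qed
  with assms show ?thesis by auto
qed

section \<open>Gaussian densities\<close>

text \<open>Gram-Schmidt for the inner product of a and b given by
  \<open>a \<bullet> (Q *v b)\<close>, adding one vector at a time.\<close>

lemma pos_def_mat_orthonormal_vectors:
  fixes Q :: "real^'n^'n"
  assumes Q: "pos_def_mat Q" and "finite I"
  shows "\<exists>v::'n \<Rightarrow> real^'n. \<forall>i\<in>I. \<forall>j\<in>I. v i \<bullet> (Q *v v j) = (if i = j then 1 else 0)"
  using \<open>finite I\<close>
proof (induction I rule: finite_induct)
  case (insert k I)
  then obtain v :: "'n \<Rightarrow> real^'n"
    where v: "\<And>i j. i \<in> I \<Longrightarrow> j \<in> I \<Longrightarrow> v i \<bullet> (Q *v v j) = (if i = j then 1 else 0)"
    by blast
  have sym: "a \<bullet> (Q *v b) = b \<bullet> (Q *v a)" for a b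
    using Q unfolding pos_def_mat_def by (metis dot_lmul_matrix inner_commute transpose_matrix_vector)
  have "dim (v ` I) < CARD('n)"
  proof -
    have "dim (v ` I) \<le> card I"
      using dim_le_card'[of "v ` I"] card_image_le[of I v] insert.hyps by simp
    also have "\<dots> < CARD('n)"
      using insert.hyps by (intro psubset_card_mono) auto
    finally show ?thesis .
  qed
  then have "span (v ` I) \<noteq> UNIV"
    using dim_span[of "v ` I"] by (metis DIM_cart DIM_real dim_UNIV mult.right_neutral nat_less_le)
  then obtain x where x: "x \<notin> span (v ` I)" by auto
  \<comment> \<open>Fewer than \<open>CARD('n)\<close> vectors have been built, so some
    \<open>x\<close> lies outside their span. Removing its \<open>Q\<close>-orthogonal projection
    leaves a nonzero vector, whose \<open>Q\<close>-length is positive and can be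
    normalized.\<close>
  define y where "y = x - (\<Sum>i\<in>I. (v i \<bullet> (Q *v x)) *\<^sub>R v i)"
  have "y \<noteq> 0"
  proof
    assume "y = 0"
    then have "x = (\<Sum>i\<in>I. (v i \<bullet> (Q *v x)) *\<^sub>R v i)" by (simp add: y_def)
    moreover have "\<dots> \<in> span (v ` I)"
      by (intro span_sum span_scale span_base) auto
    ultimately show False using x by simp
  qed
  then have yy: "y \<bullet> (Q *v y) > 0"
    using Q by (simp add: pos_def_mat_def)
  have vy: "v j \<bullet> (Q *v y) = 0" if "j \<in> I" for j
  proof -
    have "v j \<bullet> (Q *v y) = v j \<bullet> (Q *v x) - (\<Sum>i\<in>I. (v i \<bullet> (Q *v x)) * (v j \<bullet> (Q *v v i)))"
      unfolding y_def
      by (simp add: matrix_vector_mult_diff_distrib inner_diff_right inner_sum_right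
          linear_sum[OF matrix_vector_mul_linear] matrix_vector_mult_scaleR)
    also have "(\<Sum>i\<in>I. (v i \<bullet> (Q *v x)) * (v j \<bullet> (Q *v v i))) = (\<Sum>i\<in>I. if i = j then v j \<bullet> (Q *v x) else 0)"
      using that by (intro sum.cong) (auto simp: v)
    finally show ?thesis using that insert.hyps by simp
  qed
  define w where "w = v(k := (1 / sqrt (y \<bullet> (Q *v y))) *\<^sub>R y)"
  have ww: "w k \<bullet> (Q *v w k) = 1"
    using yy by (simp add: w_def matrix_vector_mult_scaleR)
  have wk: "w j \<bullet> (Q *v w k) = 0" "w k \<bullet> (Q *v w j) = 0" if "j \<in> I" for j
    using vy[OF that] sym[of "w k" "w j"] that insert.hyps
    by (auto simp: w_def matrix_vector_mult_scaleR)
  have "w i \<bullet> (Q *v w j) = (if i = j then 1 else 0)" if ij: "i \<in> insert k I" "j \<in> insert k I" for i j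
  proof -
    consider "i = k" "j = k" | "i = k" "j \<in> I" | "i \<in> I" "j = k" | "i \<in> I" "j \<in> I" using ij by blast
    then show ?thesis
      using insert.hyps by cases (use v ww wk in \<open>auto simp: w_def split: if_splits\<close>)
  qed
  then show ?case by blast
qed auto

text \<open>Take the \<open>Q\<close>-orthonormal vectors as the columns of \<open>P\<close>: entry
  (i, j) of the product is then \<open>v i \<bullet> (Q *v v j)\<close>.\<close>

lemma pos_def_mat_congruent_identity:
  fixes Q :: "real^'n^'n"
  assumes Q: "pos_def_mat Q"
  obtains P :: "real^'n^'n" where "transpose P ** Q ** P = mat 1"
proof -
  obtain v :: "'n \<Rightarrow> real^'n" where v: "\<And>i j. v i \<bullet> (Q *v v j) = (if i = j then 1 else 0)"
    using pos_def_mat_orthonormal_vectors[OF Q, of UNIV] by auto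
  define P where "P = (\<chi> i j. v j $ i)"
  have col: "P *v axis j 1 = v j" for j
    by (simp add: P_def matrix_vector_mult_basis column_def vec_eq_iff)
  have "(transpose P ** Q ** P) $ i $ j = mat 1 $ i $ j" for i j
  proof -
    have "(transpose P ** Q ** P) $ i $ j = axis i 1 \<bullet> ((transpose P ** Q ** P) *v axis j 1)"
      by (simp add: inner_axis' matrix_vector_mult_basis column_def)
    also have "\<dots> = (P *v axis i 1) \<bullet> (Q *v (P *v axis j 1))"
      by (metis dot_lmul_matrix matrix_vector_mul_assoc transpose_matrix_vector transpose_transpose)
    finally show ?thesis by (simp add: col v mat_def)
  qed
  then show thesis by (intro that[of P]) (simp add: vec_eq_iff)
qed

text \<open>The density of N(0, I) in a form free of \<open>matrix_inv\<close> and
  \<open>det\<close>. Facts about \<open>gauss\<close> with positive definite covariance are reduced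
  to it by an affine substitution.\<close>

definition std_gauss :: "real^'n \<Rightarrow> real" where
  "std_gauss z = exp (- (norm z)\<^sup>2 / 2) / sqrt ((2 * pi) ^ CARD('n))"

lemma std_gauss_pos: "std_gauss z > 0"
  by (simp add: std_gauss_def)

lemma continuous_on_std_gauss [continuous_intros]:
  "continuous_on A h \<Longrightarrow> continuous_on A (\<lambda>x. std_gauss (h x))"
  unfolding std_gauss_def by (intro continuous_intros) auto

lemma borel_measurable_std_gauss [measurable]: "std_gauss \<in> borel_measurable borel"
  by (intro borel_measurable_continuous_onI continuous_intros)

lemma std_gauss_le: "std_gauss (z :: real^'n) \<le> 1 / sqrt ((2 * pi) ^ CARD('n))"
  by (auto simp: std_gauss_def divide_simps)

text \<open>The density is a product of one-dimensional standard normal densities over the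
  coordinates, so its integral is a product of ones.\<close>

lemma nn_integral_std_gauss: "(\<integral>\<^sup>+z. ennreal (std_gauss (z :: real^'n)) \<partial>lborel) = 1"
proof -
  have "ennreal (std_gauss z) = (\<Prod>b\<in>Basis. ennreal (std_normal_density (z \<bullet> b)))" for z :: "real^'n"
  proof -
    have "(\<Prod>b\<in>Basis. std_normal_density (z \<bullet> b))
        = (\<Prod>b\<in>(Basis :: (real^'n) set). 1 / sqrt (2 * pi)) * (\<Prod>b\<in>Basis. exp (- (z \<bullet> b)\<^sup>2 / 2))"
      unfolding std_normal_density_def by (rule prod.distrib)
    also have "(\<Prod>b\<in>Basis. exp (- (z \<bullet> b)\<^sup>2 / 2)) = exp (\<Sum>b\<in>Basis. - (z \<bullet> b)\<^sup>2 / 2)"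
      by (rule exp_sum[symmetric]) simp
    also have "(\<Sum>b\<in>Basis. - (z \<bullet> b)\<^sup>2 / 2) = - (norm z)\<^sup>2 / 2"
      unfolding power2_norm_eq_inner
      by (subst euclidean_inner) (simp add: sum_divide_distrib sum_negf power2_eq_square)
    also have "(\<Prod>b\<in>(Basis :: (real^'n) set). 1 / sqrt (2 * pi)) = 1 / sqrt ((2 * pi) ^ CARD('n))"
      by (simp add: power_one_over real_sqrt_power power_mult_distrib real_sqrt_mult)
    finally have "std_gauss z = (\<Prod>b\<in>Basis. std_normal_density (z \<bullet> b))"
      by (simp add: std_gauss_def)
    then show ?thesis by (simp add: prod_ennreal)
  qed
  then have "(\<integral>\<^sup>+z. ennreal (std_gauss (z :: real^'n)) \<partial>lborel)
      = (\<Prod>b\<in>(Basis :: (real^'n) set). (\<integral>\<^sup>+x. ennreal (std_normal_density x) \<partial>lborel))"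
    using nn_integral_lborel_prod[of "\<lambda>(_::real^'n) x. ennreal (std_normal_density x)"] by simp
  also have "(\<integral>\<^sup>+x. ennreal (std_normal_density x) \<partial>lborel) = 1"
    by (subst nn_integral_eq_integral) auto
  finally show ?thesis by simp
qed

lemma integrable_std_gauss: "integrable lborel (std_gauss :: real^'n \<Rightarrow> real)"
  by (rule integrableI_nonneg) (auto simp: nn_integral_std_gauss less_imp_le[OF std_gauss_pos])

text \<open>The assumption says that the inverse of \<open>S\<close> is
  \<open>transpose R ** R\<close> and that \<open>det S\<close> is the inverse square of
  \<open>det R\<close>. Hence the quadratic form becomes a squared norm and the normalization
  produces the factor \<open>\<bar>det R\<bar>\<close>.\<close>

lemma gauss_eq_std_gauss:
  fixes R S :: "real^'n^'n"
  assumes RS: "R ** S ** transpose R = mat 1"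
  shows "gauss mu S x = \<bar>det R\<bar> * std_gauss (R *v (x - mu))" "det R \<noteq> 0"
proof -
  have "det R * det S * det R = 1"
    using arg_cong[OF RS, of det] by (simp add: det_mul)
  then show dR: "det R \<noteq> 0" by auto
  have d: "det S = 1 / (det R)\<^sup>2"
    using \<open>det R * det S * det R = 1\<close> dR by (simp add: field_simps power2_eq_square)
  have l: "transpose R ** R ** S = mat 1"
    using RS matrix_left_right_inverse[of "R ** S" "transpose R"] by (simp add: matrix_mul_assoc)
  then have r: "S ** (transpose R ** R) = mat 1"
    using matrix_left_right_inverse by blast
  \<comment> \<open>\<open>matrix_inv\<close> is a choice term, so exhibiting one two-sided inverse
    is what gives access to it; uniqueness of inverses then identifies it.\<close>
  have inv: "matrix_inv S = transpose R ** R"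
  proof -
    have "S ** matrix_inv S = mat 1 \<and> matrix_inv S ** S = mat 1"
      unfolding matrix_inv_def by (rule someI[of _ "transpose R ** R"]) (use l r in auto)
    then show ?thesis using l
      by (metis matrix_mul_assoc matrix_mul_lid matrix_mul_rid)
  qed
  have "y \<bullet> (matrix_inv S *v y) = (norm (R *v y))\<^sup>2" for y
    unfolding inv power2_norm_eq_inner
    by (metis dot_lmul_matrix matrix_vector_mul_assoc transpose_matrix_vector transpose_transpose)
  then show "gauss mu S x = \<bar>det R\<bar> * std_gauss (R *v (x - mu))"
    by (simp add: gauss_def std_gauss_def d real_sqrt_divide real_sqrt_mult)
qed

text \<open>Whitening: \<open>R\<close> is the transpose of a matrix that brings \<open>S\<close> to
  the identity by congruence.\<close>

lemma pos_def_mat_obtain_std_gauss: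
  fixes S :: "real^'n^'n"
  assumes "pos_def_mat S"
  obtains R where "det R \<noteq> 0" "\<And>mu x. gauss mu S x = \<bar>det R\<bar> * std_gauss (R *v (x - mu))"
  by (metis pos_def_mat_congruent_identity[OF assms] gauss_eq_std_gauss transpose_transpose)

lemma mat_mult_vector: "mat c *v x = c *\<^sub>R x" for x :: "real^'n"
  by (simp add: matrix_vector_mult_def mat_def vec_eq_iff if_distrib[of "\<lambda>x. x * _"] cong: if_cong)

lemma gauss_mat:
  fixes mu x :: "real^'n"
  assumes "s > 0"
  shows "gauss mu (mat (s\<^sup>2)) x = std_gauss ((1 / s) *\<^sub>R (x - mu)) / s ^ CARD('n)"
proof -
  have "mat (1/s) ** mat (s\<^sup>2) ** transpose (mat (1/s)) = (mat 1 :: real^'n^'n)"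
    using assms by (simp add: matrix_eq matrix_vector_mul_assoc[symmetric] mat_mult_vector
        transpose_mat power2_eq_square)
  note gauss_eq_std_gauss(1)[OF this, of mu x]
  moreover have "det (mat (1/s) :: real^'n^'n) = (1/s) ^ CARD('n)"
    by (subst det_diagonal) (auto simp: mat_def)
  ultimately show ?thesis using assms by (simp add: power_one_over mat_mult_vector)
qed

lemma pos_def_mat_mat: "s > 0 \<Longrightarrow> pos_def_mat (mat s :: real^'n^'n)"
  by (simp add: pos_def_mat_def transpose_mat mat_mult_vector)

lemma gauss_pos: "pos_def_mat S \<Longrightarrow> gauss mu S x > 0"
  by (elim pos_def_mat_obtain_std_gauss) (simp add: std_gauss_pos)

lemma continuous_on_gauss:
  assumes "pos_def_mat S" "continuous_on A m" "continuous_on A h"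
  shows "continuous_on A (\<lambda>x. gauss (m x) S (h x))"
  using assms(1)
proof (rule pos_def_mat_obtain_std_gauss)
  fix R assume R: "\<And>mu x. gauss mu S x = \<bar>det R\<bar> * std_gauss (R *v (x - mu))"
  show ?thesis unfolding R using assms(2,3)
    by (intro continuous_intros continuous_on_compose2[OF matrix_vector_mult_linear_continuous_on]) auto
qed

lemma borel_measurable_gauss:
  "pos_def_mat S \<Longrightarrow> (\<lambda>x. gauss mu S x) \<in> borel_measurable borel"
  by (intro borel_measurable_continuous_onI continuous_on_gauss continuous_intros)

text \<open>After translating the centre to 0, the Jacobian of \<open>R\<close> cancels the factor
  \<open>\<bar>det R\<bar>\<close>, which leaves the integral of \<open>std_gauss\<close>.\<close>

lemma nn_integral_gauss:
  assumes "pos_def_mat S"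
  shows "(\<integral>\<^sup>+x. ennreal (gauss mu S x) \<partial>lborel) = 1"
  using assms
proof (rule pos_def_mat_obtain_std_gauss)
  fix R assume dR: "det R \<noteq> 0" and R: "\<And>mu x. gauss mu S x = \<bar>det R\<bar> * std_gauss (R *v (x - mu))"
  have [measurable]: "(\<lambda>x. std_gauss (R *v x)) \<in> borel_measurable borel"
    by (intro borel_measurable_continuous_onI continuous_intros matrix_vector_mult_linear_continuous_on)
  have "(\<integral>\<^sup>+x. ennreal (gauss mu S x) \<partial>lborel)
      = \<bar>det R\<bar> * (\<integral>\<^sup>+x. ennreal (std_gauss (R *v (x - mu))) \<partial>lborel)"
    by (simp add: R ennreal_mult' nn_integral_cmult)
  also have "(\<integral>\<^sup>+x. ennreal (std_gauss (R *v (x - mu))) \<partial>lborel)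
      = (\<integral>\<^sup>+x. ennreal (std_gauss (R *v x)) \<partial>distr lborel borel ((+) (- mu)))"
    by (subst nn_integral_distr) auto
  also have "\<dots> = (\<integral>\<^sup>+x. ennreal (std_gauss (R *v x)) \<partial>lborel)"
    by (simp add: lborel_distr_plus)
  also have "\<bar>det R\<bar> * \<dots> = 1"
    using nn_integral_lborel_linear[of "(*v) R" "\<lambda>x. ennreal (std_gauss x)"] dR
    by (simp add: nn_integral_std_gauss)
  finally show ?thesis .
qed

text \<open>An injective linear map is bounded below, so \<open>norm (R *v (x - mu))\<close> is at
  least a multiple of \<open>norm (x - mu)\<close>. The centre is removed by |x|^2 \<le> 2|x - mu|^2
  + 2|mu|^2, at the cost of half the decay rate and a larger constant.\<close>

lemma gauss_le_exp:
  assumes "pos_def_mat S"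
  shows "\<exists>K c. K > 0 \<and> c > 0 \<and> (\<forall>x. gauss mu S x \<le> K * exp (- c * (norm x)\<^sup>2))"
  using assms
proof (rule pos_def_mat_obtain_std_gauss)
  fix R :: "real^'a^'a"
  assume dR: "det R \<noteq> 0" and R: "\<And>mu x. gauss mu S x = \<bar>det R\<bar> * std_gauss (R *v (x - mu))"
  have "inj ((*v) R)"
    using dR det_nz_iff_inj[OF matrix_vector_mul_linear, of R] by simp
  then obtain B where B: "B > 0" "\<And>x. B * norm x \<le> norm (R *v x)"
    using linear_inj_bounded_below_pos[OF matrix_vector_mul_linear] by blast
  define D where "D = \<bar>det R\<bar> / sqrt ((2 * pi) ^ CARD('a))"
  have "gauss mu S x \<le> D * exp (B\<^sup>2 / 2 * (norm mu)\<^sup>2) * exp (- (B\<^sup>2 / 4) * (norm x)\<^sup>2)" for x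
  proof -
    have "(norm x)\<^sup>2 \<le> (norm (x - mu) + norm mu)\<^sup>2"
      using norm_triangle_sub[of x mu] by (intro power_mono) (simp_all add: add.commute)
    also have "\<dots> \<le> 2 * (norm (x - mu))\<^sup>2 + 2 * (norm mu)\<^sup>2"
      using sum_squares_bound[of "norm (x - mu)" "norm mu"] by (simp add: power2_sum)
    finally have "B\<^sup>2 * ((norm x)\<^sup>2 / 2 - (norm mu)\<^sup>2) \<le> B\<^sup>2 * (norm (x - mu))\<^sup>2"
      by (intro mult_left_mono) auto
    also have "\<dots> \<le> (norm (R *v (x - mu)))\<^sup>2"
      using power_mono[OF B(2), of "x - mu" 2] B(1) by (simp add: power_mult_distrib)
    finally have "exp (- (norm (R *v (x - mu)))\<^sup>2 / 2) \<le> exp (B\<^sup>2 / 2 * (norm mu)\<^sup>2 + - (B\<^sup>2 / 4) * (norm x)\<^sup>2)"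
      by (simp add: algebra_simps)
    then have "D * exp (- (norm (R *v (x - mu)))\<^sup>2 / 2) \<le> D * exp (B\<^sup>2 / 2 * (norm mu)\<^sup>2 + - (B\<^sup>2 / 4) * (norm x)\<^sup>2)"
      by (intro mult_left_mono) (auto simp: D_def)
    then have "D * exp (- (norm (R *v (x - mu)))\<^sup>2 / 2) \<le> D * exp (B\<^sup>2 / 2 * (norm mu)\<^sup>2) * exp (- (B\<^sup>2 / 4) * (norm x)\<^sup>2)"
      unfolding exp_add by (simp only: mult.assoc)
    moreover have "gauss mu S x = D * exp (- (norm (R *v (x - mu)))\<^sup>2 / 2)"
      by (simp add: R std_gauss_def D_def)
    ultimately show ?thesis by simp
  qed
  moreover have "D > 0" using dR by (simp add: D_def)
  ultimately show ?thesis using B(1)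
    by (intro exI[of _ "D * exp (B\<^sup>2 / 2 * (norm mu)\<^sup>2)"] exI[of _ "B\<^sup>2 / 4"]) auto
qed

section \<open>Gaussian mixtures and relative entropy\<close>

lemma GMME:
  fixes g :: "real^'n \<Rightarrow> real"
  assumes "g \<in> GMM"
  obtains m :: nat and p and mu :: "nat \<Rightarrow> real^'n" and S
  where "\<And>j. j < m \<Longrightarrow> p j \<ge> 0" "(\<Sum>j<m. p j) = 1" "\<And>j. j < m \<Longrightarrow> pos_def_mat (S j)"
    "g = (\<lambda>x. \<Sum>j<m. p j * gauss (mu j) (S j) x)"
  using assms unfolding GMM_def by blast

text \<open>Frees mixtures from indexing by an initial segment of the naturals. The components can
  then be indexed by the values of a simple function.\<close>

lemma GMM_finite_mixture:
  fixes mu :: "'a \<Rightarrow> real^'n"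
  assumes A: "finite A" and p: "\<And>a. a \<in> A \<Longrightarrow> p a \<ge> 0" "sum p A = 1"
    and S: "\<And>a. a \<in> A \<Longrightarrow> pos_def_mat (S a)"
  shows "(\<lambda>x. \<Sum>a\<in>A. p a * gauss (mu a) (S a) x) \<in> GMM"
proof -
  obtain e where e: "bij_betw e {..<card A} A"
    using ex_bij_betw_nat_finite[OF A] by (auto simp: atLeast0LessThan)
  then have eA: "e j \<in> A" if "j < card A" for j
    using that by (auto simp: bij_betw_def)
  have "card A \<ge> 1"
    using A p(2) by (metis One_nat_def Suc_leI card_gt_0_iff sum.empty zero_neq_one)
  moreover have "(\<Sum>j<card A. p (e j)) = 1"
    using sum.reindex_bij_betw[OF e, of p] p(2) by simp
  moreover have "(\<lambda>x. \<Sum>a\<in>A. p a * gauss (mu a) (S a) x)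
      = (\<lambda>x. \<Sum>j<card A. p (e j) * gauss (mu (e j)) (S (e j)) x)"
    by (intro ext sum.reindex_bij_betw[OF e, symmetric])
  ultimately show ?thesis
    unfolding GMM_def using eA p(1) S by (intro CollectI exI conjI) auto
qed

lemma GMM_gauss: "pos_def_mat S \<Longrightarrow> gauss mu S \<in> GMM"
  using GMM_finite_mixture[of "{()}" "\<lambda>_. 1" "\<lambda>_. S" "\<lambda>_. mu"] by simp

lemma GMM_mix_gauss:
  fixes g :: "real^'n \<Rightarrow> real"
  assumes "g \<in> GMM" "pos_def_mat S" "0 \<le> d" "d \<le> 1"
  shows "(\<lambda>x. (1 - d) * g x + d * gauss mu S x) \<in> GMM"
proof -
  obtain m :: nat and p and mu' :: "nat \<Rightarrow> real^'n" and S' where g: "\<And>j. j < m \<Longrightarrow> p j \<ge> 0" "(\<Sum>j<m. p j) = 1" "\<And>j. j < m \<Longrightarrow> pos_def_mat (S' j)"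
    "g = (\<lambda>x. \<Sum>j<m. p j * gauss (mu' j) (S' j) x)"
    using \<open>g \<in> GMM\<close> by (rule GMME) blast
  \<comment> \<open>The new Gaussian is appended at index \<open>m\<close>, behind the rescaled old
    components.\<close>
  let ?p = "(\<lambda>j. (1 - d) * p j)(m := d)" and ?mu = "mu'(m := mu)" and ?S = "S'(m := S)"
  have "(\<lambda>x. \<Sum>j\<in>{..<Suc m}. ?p j * gauss (?mu j) (?S j) x) \<in> GMM"
    using g assms(2-)
    by (intro GMM_finite_mixture) (auto simp: less_Suc_eq sum_distrib_left[symmetric])
  also have "(\<lambda>x. \<Sum>j\<in>{..<Suc m}. ?p j * gauss (?mu j) (?S j) x) = (\<lambda>x. (1 - d) * g x + d * gauss mu S x)"
    by (simp add: g(4) sum_distrib_left mult.assoc)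
  finally show ?thesis .
qed

lemma GMM_pos:
  fixes g :: "real^'n \<Rightarrow> real"
  assumes "g \<in> GMM" shows "g x > 0"
proof -
  obtain m :: nat and p and mu :: "nat \<Rightarrow> real^'n" and S where g: "\<And>j. j < m \<Longrightarrow> p j \<ge> 0" "(\<Sum>j<m. p j) = 1" "\<And>j. j < m \<Longrightarrow> pos_def_mat (S j)"
    "g = (\<lambda>x. \<Sum>j<m. p j * gauss (mu j) (S j) x)"
    using \<open>g \<in> GMM\<close> by (rule GMME) blast
  obtain j where "j < m" "p j \<noteq> 0"
    using g(2) by (metis lessThan_iff sum.neutral zero_neq_one)
  then show ?thesis using g
    unfolding g(4)
    by (intro sum_pos2[of _ j] mult_pos_pos mult_nonneg_nonneg gauss_pos less_imp_le[OF gauss_pos])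
      (auto simp: less_le)
qed

lemma borel_measurable_GMM:
  fixes g :: "real^'n \<Rightarrow> real"
  assumes "g \<in> GMM" shows "g \<in> borel_measurable borel"
proof -
  obtain m :: nat and p and mu :: "nat \<Rightarrow> real^'n" and S where g: "\<And>j. j < m \<Longrightarrow> p j \<ge> 0" "(\<Sum>j<m. p j) = 1" "\<And>j. j < m \<Longrightarrow> pos_def_mat (S j)"
    "g = (\<lambda>x. \<Sum>j<m. p j * gauss (mu j) (S j) x)"
    using \<open>g \<in> GMM\<close> by (rule GMME) blast
  show ?thesis
    unfolding g(4) using g(3)
    by (intro borel_measurable_sum borel_measurable_times borel_measurable_gauss) auto
qed

lemma nn_integral_GMM:
  fixes g :: "real^'n \<Rightarrow> real"
  assumes "g \<in> GMM" shows "(\<integral>\<^sup>+x. ennreal (g x) \<partial>lborel) = 1"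
proof -
  obtain m :: nat and p and mu :: "nat \<Rightarrow> real^'n" and S where g: "\<And>j. j < m \<Longrightarrow> p j \<ge> 0" "(\<Sum>j<m. p j) = 1" "\<And>j. j < m \<Longrightarrow> pos_def_mat (S j)"
    "g = (\<lambda>x. \<Sum>j<m. p j * gauss (mu j) (S j) x)"
    using \<open>g \<in> GMM\<close> by (rule GMME) blast
  have "(\<integral>\<^sup>+x. ennreal (g x) \<partial>lborel)
      = (\<integral>\<^sup>+x. (\<Sum>j<m. ennreal (p j) * ennreal (gauss (mu j) (S j) x)) \<partial>lborel)"
  proof (rule nn_integral_cong)
    fix x
    have "(\<Sum>j<m. ennreal (p j) * ennreal (gauss (mu j) (S j) x)) = (\<Sum>j<m. ennreal (p j * gauss (mu j) (S j) x))"
      using g(1,3) by (intro sum.cong) (auto simp: ennreal_mult gauss_pos less_imp_le)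
    also have "\<dots> = ennreal (g x)"
      unfolding g(4) using g(1,3) by (intro sum_ennreal) (auto simp: gauss_pos less_imp_le)
    finally show "ennreal (g x) = (\<Sum>j<m. ennreal (p j) * ennreal (gauss (mu j) (S j) x))" ..
  qed
  also have "\<dots> = (\<Sum>j<m. ennreal (p j) * (\<integral>\<^sup>+x. ennreal (gauss (mu j) (S j) x) \<partial>lborel))"
    using borel_measurable_gauss[OF g(3)]
    by (subst nn_integral_sum) (auto intro!: sum.cong nn_integral_cmult)
  also have "\<dots> = ennreal (\<Sum>j<m. p j)"
    using g(1,3) by (subst sum_ennreal[symmetric]) (auto simp: nn_integral_gauss)
  finally show ?thesis by (simp add: g(2))
qed

lemma GMM_le_exp:
  fixes g :: "real^'n \<Rightarrow> real"
  assumes "g \<in> GMM"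
  shows "\<exists>K c. K > 0 \<and> c > 0 \<and> (\<forall>x. g x \<le> K * exp (- c * (norm x)\<^sup>2))"
proof -
  obtain m :: nat and p and mu :: "nat \<Rightarrow> real^'n" and S where g: "\<And>j. j < m \<Longrightarrow> p j \<ge> 0" "(\<Sum>j<m. p j) = 1" "\<And>j. j < m \<Longrightarrow> pos_def_mat (S j)"
    "g = (\<lambda>x. \<Sum>j<m. p j * gauss (mu j) (S j) x)"
    using \<open>g \<in> GMM\<close> by (rule GMME) blast
  have "\<exists>K c. K > 0 \<and> c > 0 \<and> (\<forall>x. (\<Sum>j<k. p j * gauss (mu j) (S j) x) \<le> K * exp (- c * (norm x)\<^sup>2))"
    if "k \<le> m" for k
    using that
  proof (induction k)
    case 0
    then show ?case by (auto intro!: exI[of _ 1])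
  next
    case (Suc k)
    then obtain K c where K: "K > 0" "c > 0"
      "\<And>x. (\<Sum>j<k. p j * gauss (mu j) (S j) x) \<le> K * exp (- c * (norm x)\<^sup>2)" by auto
    obtain K' c' where K': "K' > 0" "c' > 0" "\<And>x. gauss (mu k) (S k) x \<le> K' * exp (- c' * (norm x)\<^sup>2)"
      using gauss_le_exp[OF g(3)[of k], of "mu k"] Suc.prems by (auto simp: Suc_le_eq)
    have pk: "p k \<ge> 0" using g(1) Suc.prems by simp
    \<comment> \<open>The slower of the two decay rates bounds both the partial sum and the new
      component.\<close>
    let ?e = "\<lambda>x. exp (- (min c c') * (norm x)\<^sup>2)"
    have "(\<Sum>j<Suc k. p j * gauss (mu j) (S j) x) \<le> (K + p k * K') * ?e x" for x
    proof -
      have "(\<Sum>j<k. p j * gauss (mu j) (S j) x) \<le> K * ?e x"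
        by (rule order_trans[OF K(3)]) (use K in \<open>auto intro!: mult_left_mono mult_right_mono\<close>)
      moreover have "gauss (mu k) (S k) x \<le> K' * ?e x"
        by (rule order_trans[OF K'(3)]) (use K' in \<open>auto intro!: mult_left_mono mult_right_mono\<close>)
      then have "p k * gauss (mu k) (S k) x \<le> p k * (K' * ?e x)"
        using pk by (rule mult_left_mono)
      ultimately show ?thesis by (simp add: algebra_simps)
    qed
    moreover have "K + p k * K' > 0" "min c c' > 0" using K K' pk by (auto intro: add_pos_nonneg)
    ultimately show ?case by blast
  qed
  from this[of m] g(4) show ?thesis by auto
qed

section \<open>Relative entropy against a mixture: sign and second moments\<close>

lemma KL_pos_part:
  assumes "\<And>x. g x > 0"
  shows "KL f g = enn2ereal (\<integral>\<^sup>+x. ennreal (f x * ln (f x / g x)) \<partial>lebesgue)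
    - enn2ereal (\<integral>\<^sup>+x. ennreal (- (f x * ln (f x / g x))) \<partial>lebesgue)"
proof -
  have m: "ennreal (max 0 a) = ennreal a" for a :: real
    by (cases "a \<ge> 0") (auto simp: max_def ennreal_neg)
  show ?thesis
    unfolding KL_def m using assms by (simp add: not_le[THEN iffD2])
qed

text \<open>This is ln t \<le> t - 1 at t = b / a, multiplied by \<open>a\<close>. It is the
  pointwise source of both the Gibbs inequality and the second moment bound.\<close>

lemma mult_ln_divide_ge:
  fixes a b :: real
  assumes "a \<ge> 0" "b > 0"
  shows "a * ln (a / b) \<ge> a - b"
proof (cases "a = 0")
  case False
  then have "ln (b / a) \<le> b / a - 1" using assms by (intro ln_le_minus_one) auto
  then have "a * ln (b / a) \<le> a * (b / a - 1)" using assms by (intro mult_left_mono) auto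
  then show ?thesis using assms False by (simp add: ln_div algebra_simps)
qed (use assms in auto)

lemma borel_measurable_lebesgueI:
  fixes g :: "real^'n \<Rightarrow> 'b::topological_space"
  shows "g \<in> borel_measurable borel \<Longrightarrow> g \<in> borel_measurable lebesgue"
  by (simp add: measurable_completion)

lemma nn_integral_lebesgue_GMM:
  "g \<in> GMM \<Longrightarrow> (\<integral>\<^sup>+x. ennreal (g x) \<partial>lebesgue) = 1"
  using nn_integral_GMM borel_measurable_GMM by (subst nn_integral_completion) auto

text \<open>Gibbs inequality: the integrand is at least \<open>f x - g x\<close>, and
  \<open>f\<close> and \<open>g\<close> both have integral 1.\<close>

lemma KL_GMM_nonneg:
  assumes f: "is_density f" and g: "g \<in> GMM"
  shows "KL f g \<ge> 0"
proof -
  let ?t = "\<lambda>x. f x * ln (f x / g x)"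
  let ?P = "\<integral>\<^sup>+x. ennreal (?t x) \<partial>lebesgue" and ?N = "\<integral>\<^sup>+x. ennreal (- ?t x) \<partial>lebesgue"
  have [measurable]: "f \<in> borel_measurable lebesgue" and f0: "\<And>x. f x \<ge> 0"
    and f1: "(\<integral>\<^sup>+x. ennreal (f x) \<partial>lebesgue) = 1"
    using f by (auto simp: is_density_def)
  have [measurable]: "g \<in> borel_measurable lebesgue"
    using g borel_measurable_GMM borel_measurable_lebesgueI by blast
  \<comment> \<open>Negative terms are moved across, so that both sides integrate in
    \<open>ennreal\<close> and no infinite quantities are subtracted; the common 1 is cancelled
    afterwards.\<close>
  have pw: "ennreal (- ?t x) + ennreal (f x) \<le> ennreal (?t x) + ennreal (g x)" for x
  proof -
    have g0: "g x > 0" using GMM_pos[OF g] .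
    have "?t x \<ge> f x - g x" using mult_ln_divide_ge[OF f0 g0] .
    then show ?thesis using f0[of x] g0
      by (cases "?t x \<ge> 0")
        (auto simp: ennreal_neg ennreal_plus[symmetric] simp del: ennreal_plus intro!: ennreal_leI)
  qed
  have "?N + 1 = (\<integral>\<^sup>+x. ennreal (- ?t x) + ennreal (f x) \<partial>lebesgue)"
    by (subst nn_integral_add) (auto simp: f1)
  also have "\<dots> \<le> (\<integral>\<^sup>+x. ennreal (?t x) + ennreal (g x) \<partial>lebesgue)"
    by (rule nn_integral_mono) (rule pw)
  also have "\<dots> = ?P + 1"
    by (subst nn_integral_add) (auto simp: nn_integral_lebesgue_GMM[OF g])
  finally have "?N \<le> ?P" by (simp add: add.commute ennreal_add_left_cancel_le)
  then have "enn2ereal ?N \<le> enn2ereal ?P" by (simp add: less_eq_ennreal.rep_eq)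
  then show ?thesis
    unfolding KL_pos_part[OF GMM_pos[OF g]]
    by (rule ereal_diff_positive)
qed

lemma second_moment_finite_if_KL_finite:
  fixes f :: "real^'n \<Rightarrow> real"
  assumes f: "is_density f" and g: "g \<in> GMM" and fin: "KL f g < \<infinity>"
  shows "(\<integral>\<^sup>+ x. ennreal ((norm x)\<^sup>2 * f x) \<partial>lebesgue) < \<infinity>"
proof -
  let ?t = "\<lambda>x. f x * ln (f x / g x)"
  have [measurable]: "f \<in> borel_measurable lebesgue" and f0: "\<And>x. f x \<ge> 0"
    and f1: "(\<integral>\<^sup>+x. ennreal (f x) \<partial>lebesgue) = 1"
    using f by (auto simp: is_density_def)
  have [measurable]: "g \<in> borel_measurable lebesgue"
    using g borel_measurable_GMM borel_measurable_lebesgueI by blast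
  have [measurable]: "norm \<in> borel_measurable (lebesgue :: (real^'n) measure)"
    by (rule borel_measurable_lebesgueI) simp
  \<comment> \<open>In \<open>ereal\<close>, infinity minus anything is infinity, even infinity
    minus infinity. A finite divergence therefore forces a finite positive part.\<close>
  have P: "(\<integral>\<^sup>+x. ennreal (?t x) \<partial>lebesgue) < \<infinity>"
    using fin unfolding KL_pos_part[OF GMM_pos[OF g]]
    by (cases "\<integral>\<^sup>+x. ennreal (?t x) \<partial>lebesgue") (auto simp: top_ennreal.rep_eq)
  obtain K c where K: "K > 0" "c > 0" "\<And>x. g x \<le> K * exp (- c * (norm x)\<^sup>2)"
    using GMM_le_exp[OF g] by blast
  \<comment> \<open>With variance 1 / c the Gaussian \<open>?q\<close> is a multiple of
    exp(-(c/2)|x|^2), which decays at half the rate of the bound on \<open>g\<close>;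
    \<open>D\<close> is the normalizing constant.\<close>
  define s where "s = 1 / sqrt c"
  have s: "s > 0" "1 / s\<^sup>2 = c" using K(2) by (auto simp: s_def power_divide)
  define D where "D = s ^ CARD('n) * sqrt ((2 * pi) ^ CARD('n))"
  have D: "D > 0" using s by (simp add: D_def)
  let ?q = "gauss 0 (mat (s\<^sup>2)) :: real^'n \<Rightarrow> real"
  have q: "?q \<in> GMM" using s by (intro GMM_gauss pos_def_mat_mat) simp
  have [measurable]: "?q \<in> borel_measurable lebesgue"
    using q borel_measurable_GMM borel_measurable_lebesgueI by blast
  have exq: "exp (- (c / 2) * (norm x)\<^sup>2) = D * ?q x" for x :: "real^'n"
    using s(1) by (simp add: gauss_mat std_gauss_def D_def power_mult_distrib power_divide s(2)[symmetric])
  \<comment> \<open>Writing e for the slower exponential, the integrand is f ln(f/e) - (c/2)|x|^2 f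
    - f ln g. Here f ln(f/e) \<ge> f - e, while -ln g \<ge> c|x|^2 - ln K; so half of the quadratic
    term survives.\<close>
  have pw: "ennreal (c / 2) * ennreal ((norm x)\<^sup>2 * f x)
      \<le> ennreal (?t x) + ennreal D * ennreal (?q x) + ennreal \<bar>ln K\<bar> * ennreal (f x)" for x
  proof -
    let ?e = "exp (- (c / 2) * (norm x)\<^sup>2)"
    have gx: "g x > 0" using GMM_pos[OF g] .
    have "f x * (ln K - c * (norm x)\<^sup>2 - ln (g x)) \<ge> 0"
    proof (intro mult_nonneg_nonneg f0)
      have "ln (g x) \<le> ln (K * exp (- c * (norm x)\<^sup>2))"
        using K(1,3) gx by (intro ln_mono) auto
      then show "0 \<le> ln K - c * (norm x)\<^sup>2 - ln (g x)" using K(1) by (simp add: ln_mult)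
    qed
    moreover have "?t x = f x * ln (f x / ?e) - f x * (c / 2 * (norm x)\<^sup>2) - f x * ln (g x)"
      using gx f0[of x] by (cases "f x = 0") (auto simp: ln_div algebra_simps)
    moreover have "f x * ln (f x / ?e) \<ge> f x - ?e"
      by (rule mult_ln_divide_ge) (use f0 in auto)
    moreover have "f x * ln K \<le> \<bar>ln K\<bar> * f x" 
      using mult_right_mono[OF abs_ge_self[of "ln K"] f0[of x]] by (simp add: mult.commute)
    ultimately have "c / 2 * ((norm x)\<^sup>2 * f x) \<le> ?t x + D * ?q x + \<bar>ln K\<bar> * f x"
      unfolding exq[symmetric] using f0[of x] by (simp add: algebra_simps)
    moreover have "D * ?q x \<ge> 0" using exq[of x] by (metis exp_ge_zero)
    moreover have "?t x \<le> max 0 (?t x)" by simp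
    moreover have "ennreal (max 0 (?t x)) = ennreal (?t x)"
      by (cases "?t x \<ge> 0") (auto simp: max_def ennreal_neg)
    ultimately have "ennreal (c / 2 * ((norm x)\<^sup>2 * f x)) \<le> ennreal (max 0 (?t x) + D * ?q x + \<bar>ln K\<bar> * f x)"
      by (intro ennreal_leI) linarith
    also have "\<dots> = ennreal (?t x) + ennreal (D * ?q x) + ennreal (\<bar>ln K\<bar> * f x)"
      using \<open>D * ?q x \<ge> 0\<close> f0[of x] \<open>ennreal (max 0 (?t x)) = ennreal (?t x)\<close> by (simp add: ennreal_plus)
    finally show ?thesis
      using K(2) D f0[of x] ennreal_mult'[of "c / 2" "(norm x)\<^sup>2 * f x"]
        ennreal_mult'[of D "?q x"] ennreal_mult'[of "\<bar>ln K\<bar>" "f x"] by simp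
  qed
  have "ennreal (c / 2) * (\<integral>\<^sup>+ x. ennreal ((norm x)\<^sup>2 * f x) \<partial>lebesgue)
      = (\<integral>\<^sup>+ x. ennreal (c / 2) * ennreal ((norm x)\<^sup>2 * f x) \<partial>lebesgue)"
    by (rule nn_integral_cmult[symmetric]) measurable
  also have "\<dots> \<le> (\<integral>\<^sup>+ x. ennreal (?t x) + ennreal D * ennreal (?q x) + ennreal \<bar>ln K\<bar> * ennreal (f x) \<partial>lebesgue)"
    by (rule nn_integral_mono) (rule pw)
  also have "\<dots> = (\<integral>\<^sup>+ x. ennreal (?t x) \<partial>lebesgue) + ennreal D + ennreal \<bar>ln K\<bar>"
    by (simp add: nn_integral_add nn_integral_cmult f1 nn_integral_lebesgue_GMM[OF q])
  also have "\<dots> < \<infinity>" using P by simp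
  finally show ?thesis
    using K(2) by (auto simp: ennreal_mult_eq_top_iff less_top ennreal_mult_less_top)
qed

section \<open>Almost everywhere limits of mixtures\<close>

text \<open>Closing inductively lets limits be nested without diagonal sequences and supplies an
  induction rule for inequalities stable under limits. Nothing is demanded of the mass of a
  limit.\<close>

inductive_set ae_closure :: "('a::euclidean_space \<Rightarrow> real) set \<Rightarrow> ('a \<Rightarrow> real) set"
  for M :: "('a \<Rightarrow> real) set" where
  base: "g \<in> M \<Longrightarrow> g \<in> ae_closure M"
| lim: "(\<And>i::nat. u i \<in> ae_closure M) \<Longrightarrow> g \<in> borel_measurable lebesgue \<Longrightarrow> (\<And>x. g x \<ge> 0)
    \<Longrightarrow> (AE x in lebesgue. (\<lambda>i. u i x) \<longlonglongrightarrow> g x) \<Longrightarrow> g \<in> ae_closure M"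

lemma gauss_bounded:
  fixes S :: "real^'n^'n"
  assumes "pos_def_mat S"
  obtains B where "\<And>mu x. gauss mu S x \<le> B"
  using assms
proof (rule pos_def_mat_obtain_std_gauss)
  fix R assume R: "\<And>mu x. gauss mu S x = \<bar>det R\<bar> * std_gauss (R *v (x - mu))"
  show thesis
    by (rule that[of "\<bar>det R\<bar> * (1 / sqrt ((2 * pi) ^ CARD('n)))"])
      (unfold R, intro mult_left_mono std_gauss_le, simp)
qed

text \<open>Replacing the centre \<open>y\<close> by simple functions \<open>s i y\<close> that
  converge to \<open>y\<close> turns the continuous mixture into finite ones, and dominated
  convergence recovers it.\<close>

lemma mixture_in_ae_closure_GMM:
  fixes v :: "real^'n \<Rightarrow> real"
  assumes v: "integrable lborel v" "\<And>x. v x \<ge> 0" "integral\<^sup>L lborel v = 1" and S: "pos_def_mat S"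
  shows "(\<lambda>x. \<integral>y. v y * gauss y S x \<partial>lborel) \<in> ae_closure GMM" (is "?g \<in> _")
proof -
  obtain B where B: "\<And>mu x. gauss mu S x \<le> B"
    using gauss_bounded[OF S] by blast
  have B0: "norm (gauss mu S x) \<le> B" for mu x
    using B[of mu x] gauss_pos[OF S, of mu x] by simp
  have "(\<lambda>x::real^'n. x) \<in> borel_measurable lborel" by simp
  from borel_measurable_implies_sequence_metric[OF this, of 0]
  obtain s :: "nat \<Rightarrow> real^'n \<Rightarrow> real^'n"
    where s: "\<And>i. simple_function lborel (s i)" and lim: "\<And>x. (\<lambda>i. s i x) \<longlonglongrightarrow> x"
    by (auto simp: space_borel)
  define w where "w i x = (\<integral>y. v y * gauss (s i y) S x \<partial>lborel)" for i x
  have [measurable]: "s i \<in> borel_measurable lborel" for i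
    using s by (rule borel_measurable_simple_function)
  have [measurable]: "v \<in> borel_measurable lborel" using v by simp
  have G [measurable]: "(\<lambda>m. gauss m S x) \<in> borel_measurable borel" for x
    using S by (intro borel_measurable_continuous_onI continuous_on_gauss continuous_intros)
  have GMM: "w i \<in> GMM" for i
  proof -
    define A where "A = range (s i)"
    have fin: "finite A" using s[of i] by (simp add: A_def simple_function_def)
    \<comment> \<open>The weight of a centre \<open>z\<close> is the mass that \<open>v\<close>
      gives to the level set of \<open>s i\<close> at \<open>z\<close>. These level sets partition
      the space, so the weights add up to 1.\<close>
    define p where "p z = (\<integral>y. v y * indicator (s i -` {z}) y \<partial>lborel)" for z
    have [measurable]: "s i -` {z} \<in> sets borel" for z
      using s[of i] by (auto simp: simple_function_def) (metis Int_UNIV_right empty_iff rangeI sets.empty_sets vimage_singleton_eq equals0I)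
    have int: "integrable lborel (\<lambda>y. v y * indicator (s i -` {z}) y)" for z
      by (rule integrable_real_mult_indicator) (use v in auto)
    have ind: "(\<Sum>z\<in>A. indicator (s i -` {z}) y * h z) = h (s i y)" for h :: "real^'n \<Rightarrow> real" and y
    proof -
      have "(\<Sum>z\<in>A. indicator (s i -` {z}) y * h z) = (\<Sum>z\<in>A. if z = s i y then h z else 0)"
        by (intro sum.cong) (auto simp: indicator_def)
      also have "\<dots> = h (s i y)" using fin by (simp add: A_def)
      finally show ?thesis .
    qed
    have eq: "w i = (\<lambda>x. \<Sum>z\<in>A. p z * gauss z S x)"
    proof
      fix x
      have "v y * gauss (s i y) S x = (\<Sum>z\<in>A. v y * indicator (s i -` {z}) y * gauss z S x)" for y
        using ind[of y "\<lambda>z. gauss z S x"] by (simp add: mult.assoc sum_distrib_left[symmetric])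
      then have "w i x = (\<integral>y. (\<Sum>z\<in>A. v y * indicator (s i -` {z}) y * gauss z S x) \<partial>lborel)"
        by (simp add: w_def)
      also have "\<dots> = (\<Sum>z\<in>A. \<integral>y. v y * indicator (s i -` {z}) y * gauss z S x \<partial>lborel)"
        by (rule Bochner_Integration.integral_sum) (intro integrable_mult_left int)
      finally show "w i x = (\<Sum>z\<in>A. p z * gauss z S x)" by (simp add: p_def)
    qed
    have "(\<Sum>z\<in>A. p z) = (\<integral>y. (\<Sum>z\<in>A. v y * indicator (s i -` {z}) y) \<partial>lborel)"
      unfolding p_def by (rule Bochner_Integration.integral_sum[symmetric]) (rule int)
    also have "(\<lambda>y. \<Sum>z\<in>A. v y * indicator (s i -` {z}) y) = v"
      using ind[of _ "\<lambda>_. 1"] by (simp add: sum_distrib_left[symmetric])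
    finally have "sum p A = 1" using v by simp
    moreover have "p z \<ge> 0" for z unfolding p_def using v by (intro integral_nonneg_AE) auto
    ultimately show ?thesis
      unfolding eq using fin S by (intro GMM_finite_mixture) auto
  qed
  have wlim: "(\<lambda>i. w i x) \<longlonglongrightarrow> ?g x" for x
    unfolding w_def
  \<comment> \<open>\<open>B\<close> bounds the Gaussians uniformly in the centre, so one dominating
    function serves all \<open>i\<close>.\<close>
  proof (rule integral_dominated_convergence[where w = "\<lambda>y. v y * B"])
    have "continuous_on UNIV (\<lambda>m. gauss m S x)"
      by (intro continuous_on_gauss S continuous_intros)
    then have "(\<lambda>i. gauss (s i y) S x) \<longlonglongrightarrow> gauss y S x" for y
      using lim[of y] continuous_on_tendsto_compose[of UNIV "\<lambda>m. gauss m S x" "\<lambda>i. s i y" y sequentially] by simp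
    then show "AE y in lborel. (\<lambda>i. v y * gauss (s i y) S x) \<longlonglongrightarrow> v y * gauss y S x"
      by (intro AE_I2 tendsto_intros)
    show "AE y in lborel. norm (v y * gauss (s i y) S x) \<le> v y * B" for i
      using v(2) B0 by (intro AE_I2) (auto simp: abs_mult intro!: mult_left_mono)
  qed (use v in auto)
  have [measurable]: "w i \<in> borel_measurable lebesgue" for i
    using GMM borel_measurable_GMM borel_measurable_lebesgueI by blast
  show ?thesis
  proof (rule ae_closure.lim[of w])
    show "w i \<in> ae_closure GMM" for i by (rule ae_closure.base) (rule GMM)
    show "?g \<in> borel_measurable lebesgue"
      by (rule borel_measurable_LIMSEQ_real[of _ w]) (use wlim in auto)
    show "?g x \<ge> 0" for x
      using v(2) gauss_pos[OF S] by (intro integral_nonneg_AE AE_I2 mult_nonneg_nonneg) (auto intro: less_imp_le)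
  qed (use wlim in auto)
qed

text \<open>The substitution y = x + s z, together with the evenness of \<open>std_gauss\<close>,
  moves the dependence on \<open>s\<close> from the kernel into the argument of \<open>v\<close>,
  where continuity of \<open>v\<close> can be used as s tends to 0.\<close>

lemma gauss_convolution_eq:
  fixes v :: "real^'n \<Rightarrow> real"
  assumes [measurable]: "v \<in> borel_measurable borel" and s: "s > 0"
  shows "(\<integral>y. v y * gauss y (mat (s\<^sup>2)) x \<partial>lborel) = (\<integral>z. v (x + s *\<^sub>R z) * std_gauss z \<partial>lborel)"
proof -
  have even: "std_gauss (- z) = std_gauss z" for z :: "real^'n"
    by (simp add: std_gauss_def)
  have eq: "s ^ CARD('n) * (v (x + s *\<^sub>R z) * gauss (x + s *\<^sub>R z) (mat (s\<^sup>2)) x) = v (x + s *\<^sub>R z) * std_gauss z" for z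
    using s even[of z] by (simp add: gauss_mat)
  have [measurable]: "(\<lambda>y. gauss y (mat (s\<^sup>2)) x) \<in> borel_measurable borel"
    using s by (intro borel_measurable_continuous_onI continuous_on_gauss pos_def_mat_mat continuous_intros) auto
  have "(\<integral>y. v y * gauss y (mat (s\<^sup>2)) x \<partial>lborel)
    = (\<integral>y. v y * gauss y (mat (s\<^sup>2)) x \<partial>density (distr lborel borel (\<lambda>z. x + s *\<^sub>R z)) (\<lambda>_. ennreal (\<bar>s\<bar> ^ DIM(real^'n))))"
    using s by (subst lborel_affine[of s x]) (auto simp: ennreal_power)
  also have "\<dots> = (\<integral>y. s ^ CARD('n) * (v y * gauss y (mat (s\<^sup>2)) x) \<partial>distr lborel borel (\<lambda>z. x + s *\<^sub>R z))"
    using s by (subst integral_density) auto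
  also have "\<dots> = (\<integral>z. v (x + s *\<^sub>R z) * std_gauss z \<partial>lborel)"
    by (subst integral_distr) (auto simp: eq simp del: integral_mult_right_zero)
  finally show ?thesis .
qed

text \<open>The convolutions of \<open>v\<close> with N(0, s^2 I) lie in the closure and tend to
  \<open>v\<close> everywhere as s tends to 0. Boundedness of \<open>v\<close> gives the dominating
  function \<open>B * std_gauss z\<close>.\<close>

lemma continuous_in_ae_closure_GMM:
  fixes v :: "real^'n \<Rightarrow> real"
  assumes v: "continuous_on UNIV v" "integrable lborel v" "integral\<^sup>L lborel v = 1"
    and b: "\<And>x. v x \<ge> 0" "\<And>x. v x \<le> B"
  shows "v \<in> ae_closure GMM"
proof -
  define s where "s i = inverse (real (Suc i))" for i
  have s: "s i > 0" "s \<longlonglongrightarrow> 0" for i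
    unfolding s_def using LIMSEQ_inverse_real_of_nat by auto
  have [measurable]: "v \<in> borel_measurable borel"
    using v(1) by (rule borel_measurable_continuous_onI)
  note int = integrable_std_gauss[where 'n = 'n]
  have int1: "integral\<^sup>L lborel (std_gauss :: real^'n \<Rightarrow> real) = 1"
    using nn_integral_eq_integral[OF int]
    by (simp add: less_imp_le[OF std_gauss_pos] nn_integral_std_gauss)
  show ?thesis
  proof (rule ae_closure.lim)
    show "(\<lambda>x. \<integral>y. v y * gauss y (mat ((s i)\<^sup>2)) x \<partial>lborel) \<in> ae_closure GMM" for i
      using s(1)[of i] v b by (intro mixture_in_ae_closure_GMM pos_def_mat_mat) auto
    show "v \<in> borel_measurable lebesgue" by (rule borel_measurable_lebesgueI) simp
    show "AE x in lebesgue. (\<lambda>i. \<integral>y. v y * gauss y (mat ((s i)\<^sup>2)) x \<partial>lborel) \<longlonglongrightarrow> v x"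
    proof (rule AE_I2)
      fix x :: "real^'n"
      have "(\<lambda>i. \<integral>z. v (x + s i *\<^sub>R z) * std_gauss z \<partial>lborel) \<longlonglongrightarrow> (\<integral>z. v x * std_gauss (z :: real^'n) \<partial>lborel)"
      proof (rule integral_dominated_convergence[where w = "\<lambda>z::real^'n. B * std_gauss z"])
        have "(\<lambda>i. v (x + s i *\<^sub>R z)) \<longlonglongrightarrow> v x" for z
        proof -
          have "(\<lambda>i. x + s i *\<^sub>R z) \<longlonglongrightarrow> x + 0 *\<^sub>R z"
            by (intro tendsto_intros s)
          then show ?thesis
            using continuous_on_tendsto_compose[OF v(1), of "\<lambda>i. x + s i *\<^sub>R z" x sequentially] by simp
        qed
        then show "AE z in lborel. (\<lambda>i. v (x + s i *\<^sub>R z) * std_gauss z) \<longlonglongrightarrow> v x * std_gauss z"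
          by (intro AE_I2 tendsto_intros)
        show "AE z in lborel. norm (v (x + s i *\<^sub>R z) * std_gauss z) \<le> B * std_gauss z" for i
          using b by (intro AE_I2) (auto simp: abs_mult less_imp_le[OF std_gauss_pos] intro!: mult_right_mono)
      qed (use int in auto)
      then show "(\<lambda>i. \<integral>y. v y * gauss y (mat ((s i)\<^sup>2)) x \<partial>lborel) \<longlonglongrightarrow> v x"
        using s(1) int1 by (simp add: gauss_convolution_eq)
    qed
  qed (use b in auto)
qed

text \<open>Under domination the total masses converge along with the functions, so normalization
  commutes with the limit.\<close>

lemma ae_closure_normalized_limit:
  fixes h :: "'a::euclidean_space \<Rightarrow> real"
  assumes [measurable]: "\<And>i. u i \<in> borel_measurable lebesgue" "h \<in> borel_measurable lebesgue"
    and u0: "\<And>i x. 0 \<le> u i x" and h0: "\<And>x. 0 \<le> h x"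
    and dom: "integrable lebesgue D" "\<And>i x. u i x \<le> D x"
    and lim: "AE x in lebesgue. (\<lambda>i. u i x) \<longlonglongrightarrow> h x"
    and cl: "\<And>i. integral\<^sup>L lebesgue (u i) > 0 \<Longrightarrow> (\<lambda>x. u i x / integral\<^sup>L lebesgue (u i)) \<in> ae_closure M"
    and pos: "integral\<^sup>L lebesgue h > 0"
  shows "(\<lambda>x. h x / integral\<^sup>L lebesgue h) \<in> ae_closure M"
proof -
  have I: "(\<lambda>i. integral\<^sup>L lebesgue (u i)) \<longlonglongrightarrow> integral\<^sup>L lebesgue h"
    by (rule integral_dominated_convergence[OF _ _ dom(1) lim]) (use u0 dom in auto)
  \<comment> \<open>Early terms may have mass 0 and no normalization; shifting the index by
    \<open>N\<close> discards them.\<close>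
  then obtain N where N: "\<And>i. i \<ge> N \<Longrightarrow> integral\<^sup>L lebesgue (u i) > 0"
    using order_tendstoD(1)[OF I pos] by (auto simp: eventually_sequentially)
  show ?thesis
  proof (rule ae_closure.lim[of "\<lambda>i x. u (i + N) x / integral\<^sup>L lebesgue (u (i + N))"])
    show "(\<lambda>x. u (i + N) x / integral\<^sup>L lebesgue (u (i + N))) \<in> ae_closure M" for i
      by (rule cl) (simp add: N)
    show "AE x in lebesgue. (\<lambda>i. u (i + N) x / integral\<^sup>L lebesgue (u (i + N))) \<longlonglongrightarrow> h x / integral\<^sup>L lebesgue h"
      using lim
    proof (rule AE_mp, intro AE_I2 impI)
      fix x assume "(\<lambda>i. u i x) \<longlonglongrightarrow> h x"
      then have "(\<lambda>i. u i x / integral\<^sup>L lebesgue (u i)) \<longlonglongrightarrow> h x / integral\<^sup>L lebesgue h"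
        using I pos by (intro tendsto_intros) auto
      then show "(\<lambda>i. u (i + N) x / integral\<^sup>L lebesgue (u (i + N))) \<longlonglongrightarrow> h x / integral\<^sup>L lebesgue h"
        by (rule LIMSEQ_ignore_initial_segment)
    qed
  qed (use h0 pos in auto)
qed

text \<open>Two nested limits. \<open>F i\<close> is \<open>f\<close> capped by a multiple of
  \<open>std_gauss\<close>, and \<open>v i n\<close> are continuous functions under the same cap
  that tend to \<open>F i\<close>. The cap makes them bounded and integrable and dominates the inner
  limit; \<open>f\<close> itself dominates the outer one.\<close>

lemma density_in_ae_closure_GMM:
  fixes f :: "real^'n \<Rightarrow> real"
  assumes "is_density f"
  shows "f \<in> ae_closure GMM"
proof -
  have f [measurable]: "f \<in> borel_measurable lebesgue" and f0: "\<And>x. f x \<ge> 0"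
    and f1: "(\<integral>\<^sup>+x. ennreal (f x) \<partial>lebesgue) = 1"
    using assms by (auto simp: is_density_def)
  have fi: "integrable lebesgue f"
    by (rule integrableI_nonneg) (auto simp: f0 f1)
  have f1': "integral\<^sup>L lebesgue f = 1"
    using nn_integral_eq_integral[OF fi] f0 f1 by simp
  have "f measurable_on UNIV"
    using f by (rule lebesgue_measurable_imp_measurable_on) simp
  then obtain N u where N: "negligible N" and u: "\<And>n. continuous_on UNIV (u n)"
    and ulim: "\<And>x. x \<notin> N \<Longrightarrow> (\<lambda>n. u n x) \<longlonglongrightarrow> f x"
    unfolding measurable_on_def by auto
  have AEN: "AE x in lebesgue. x \<notin> N"
    using N by (auto simp: negligible_iff_null_sets intro: AE_not_in)
  note int = integrable_std_gauss[where 'n = 'n]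
  have int': "integrable lebesgue (\<lambda>x::real^'n. c * std_gauss x)" for c
    using int by (simp add: integrable_completion)
  have [measurable]: "(std_gauss :: real^'n \<Rightarrow> real) \<in> borel_measurable lebesgue"
    by (rule borel_measurable_lebesgueI) simp
  define k where "k i = real (Suc i)" for i
  define F where "F i x = min (f x) (k i * std_gauss x)" for i x
  define v where "v i n x = min (max 0 (u n x)) (k i * std_gauss x)" for i n x
  have v0: "0 \<le> v i n x" and F0: "0 \<le> F i x" for i n x
    by (auto simp: v_def F_def k_def f0 less_imp_le[OF std_gauss_pos])
  have vc: "continuous_on UNIV (v i n)" for i n
    unfolding v_def[abs_def] by (intro continuous_intros u)
  then have vb [measurable]: "v i n \<in> borel_measurable borel" for i n
    by (rule borel_measurable_continuous_onI)
  have [measurable]: "v i n \<in> borel_measurable lebesgue" for i n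
    by (rule borel_measurable_lebesgueI) (rule vb)
  have vle: "v i n x \<le> \<bar>k i * std_gauss x\<bar>" for i n x by (simp add: v_def)
  have vi: "integrable lborel (v i n)" for i n
    by (rule Bochner_Integration.integrable_bound[of _ "\<lambda>x. k i * std_gauss x"])
       (use int v0 vle in auto)
  have vcl: "(\<lambda>x. v i n x / integral\<^sup>L lebesgue (v i n)) \<in> ae_closure GMM"
    if pos: "integral\<^sup>L lebesgue (v i n) > 0" for i n
  proof (rule continuous_in_ae_closure_GMM)
    have I: "integral\<^sup>L lebesgue (v i n) = integral\<^sup>L lborel (v i n)"
      by (rule integral_completion) simp
    show "(\<integral>x. v i n x / integral\<^sup>L lebesgue (v i n) \<partial>lborel) = 1"
      using pos unfolding I by simp
    show "integrable lborel (\<lambda>x. v i n x / integral\<^sup>L lebesgue (v i n))"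
      using vi by simp
    show "continuous_on UNIV (\<lambda>x. v i n x / integral\<^sup>L lebesgue (v i n))"
      using pos by (intro continuous_intros vc) auto
    show "0 \<le> v i n x / integral\<^sup>L lebesgue (v i n)" for x using pos v0[of i n x] by simp
    show "v i n x / integral\<^sup>L lebesgue (v i n) \<le> k i * (1 / sqrt ((2 * pi) ^ CARD('n))) / integral\<^sup>L lebesgue (v i n)" for x
    proof (rule divide_right_mono)
      have "v i n x \<le> k i * std_gauss x" by (simp add: v_def)
      also have "\<dots> \<le> k i * (1 / sqrt ((2 * pi) ^ CARD('n)))"
        by (intro mult_left_mono std_gauss_le) (simp add: k_def)
      finally show "v i n x \<le> k i * (1 / sqrt ((2 * pi) ^ CARD('n)))" .
    qed (use pos in simp)
  qed
  have Fm [measurable]: "F i \<in> borel_measurable lebesgue" for i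
    unfolding F_def[abs_def] by measurable
  have Fcl: "(\<lambda>x. F i x / integral\<^sup>L lebesgue (F i)) \<in> ae_closure GMM"
    if "integral\<^sup>L lebesgue (F i) > 0" for i
  proof (rule ae_closure_normalized_limit[of "v i" "F i" "\<lambda>x. k i * std_gauss x"])
    show "AE x in lebesgue. (\<lambda>n. v i n x) \<longlonglongrightarrow> F i x"
      using AEN
    proof (rule AE_mp, intro AE_I2 impI)
      fix x assume "x \<notin> N"
      then have "(\<lambda>n. min (max 0 (u n x)) (k i * std_gauss x)) \<longlonglongrightarrow> min (max 0 (f x)) (k i * std_gauss x)"
        by (intro tendsto_intros ulim)
      then show "(\<lambda>n. v i n x) \<longlonglongrightarrow> F i x"
        by (simp add: v_def F_def f0 max_absorb2)
    qed
    show "v i n x \<le> k i * std_gauss x" for n x by (simp add: v_def)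
  qed (use v0 F0 int' vcl that in auto)
  have "(\<lambda>x. f x / integral\<^sup>L lebesgue f) \<in> ae_closure GMM"
  proof (rule ae_closure_normalized_limit[of F f f])
    show "AE x in lebesgue. (\<lambda>i. F i x) \<longlonglongrightarrow> f x"
    proof (rule AE_I2)
      fix x :: "real^'n"
      \<comment> \<open>Since \<open>std_gauss x\<close> is positive, the cap eventually exceeds
        \<open>f x\<close>, and the sequence is constant from then on.\<close>
      obtain n where n: "real n > f x / std_gauss x" using reals_Archimedean2 by blast
      have "F i x = f x" if "i \<ge> n" for i
      proof -
        have "f x / std_gauss x \<le> k i" using n that by (simp add: k_def)
        then have "f x \<le> k i * std_gauss x" by (simp add: pos_divide_le_eq std_gauss_pos)
        then show ?thesis by (simp add: F_def)
      qed
      then show "(\<lambda>i. F i x) \<longlonglongrightarrow> f x"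
        by (intro tendsto_eventually) (auto simp: eventually_sequentially)
    qed
    show "F i x \<le> f x" for i x by (simp add: F_def)
  qed (use f0 F0 fi Fcl f1' in auto)
  then show ?thesis by (simp add: f1')
qed

section \<open>Vanishing relative entropy\<close>

lemma emeasure_closed_cube:
  fixes Q :: "(real^'n) set"
  assumes "closed_cube r Q" "r > 0"
  shows "emeasure lebesgue Q = ennreal (r ^ CARD('n))"
proof -
  obtain a where Q: "Q = cbox a (a + r *\<^sub>R One)"
    using assms by (auto simp: closed_cube_def)
  have "emeasure lborel (cbox a (a + r *\<^sub>R One)) = (\<Prod>b\<in>Basis. (a + r *\<^sub>R One - a) \<bullet> b)"
    using assms(2) by (intro emeasure_lborel_cbox) (auto simp: inner_add_left)
  also have "(\<Prod>b\<in>Basis. (a + r *\<^sub>R One - a) \<bullet> b) = (\<Prod>b\<in>(Basis :: (real^'n) set). r)"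
    by (intro prod.cong) auto
  finally show ?thesis by (simp add: Q)
qed

lemma FSSA_comparison_cubes:
  fixes f :: "real^'n \<Rightarrow> real"
  assumes "FSSA f"
  shows "\<exists>r C. r > 0 \<and> (\<forall>y\<in>fsupp f. closed_cube r (C y) \<and> y \<in> C y)
    \<and> Dr f C \<in> borel_measurable (restrict_space lebesgue (fsupp f))
    \<and> (\<integral>\<^sup>+ y \<in> fsupp f. Dr f C y \<partial>Fmeas f) < \<infinity>"
  using assms unfolding FSSA_def
  apply -
  apply (erule conjE, elim exE, elim conjE)
  apply (rule exI, rule exI)
  apply (rule conjI, assumption)+
  apply assumption
  done

text \<open>The infimum of a density over a cube of side \<open>r\<close> is at most \<open>r\<close> to the power minus the dimension,
  so \<open>ln f\<close> exceeds \<open>Dr\<close> by at most a constant.\<close>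
lemma FSSA_entropy_finite:
  fixes f :: "real^'n \<Rightarrow> real"
  assumes "FSSA f"
  shows "(\<integral>\<^sup>+x. ennreal (f x * max 0 (ln (f x))) \<partial>lebesgue) < \<infinity>"
proof -
  have f [measurable]: "f \<in> borel_measurable lebesgue" and f0: "\<And>x. f x \<ge> 0"
    and f1: "(\<integral>\<^sup>+x. ennreal (f x) \<partial>lebesgue) = 1"
    using assms by (auto simp: FSSA_def is_density_def)
  obtain r and C :: "real^'n \<Rightarrow> (real^'n) set"
    where r: "r > 0" and C: "\<forall>y\<in>fsupp f. closed_cube r (C y) \<and> y \<in> C y"
    and Dm: "Dr f C \<in> borel_measurable (restrict_space lebesgue (fsupp f))"
    and Di: "(\<integral>\<^sup>+ y \<in> fsupp f. Dr f C y \<partial>Fmeas f) < \<infinity>"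
    using FSSA_comparison_cubes[OF assms] by blast
  have "fsupp f = f -` {0<..} \<inter> space lebesgue" by (auto simp: fsupp_def)
  then have supp: "fsupp f \<in> sets lebesgue"
    using measurable_sets[OF f, of "{0<..}"] by simp
  have m [measurable]: "(\<lambda>x. Dr f C x * indicator (fsupp f) x) \<in> borel_measurable lebesgue"
    using Dm supp by (simp add: borel_measurable_restrict_space_iff_ennreal)
  define c where "c = \<bar>ln (r ^ CARD('n))\<bar>"
  \<comment> \<open>For positive infimum \<open>i\<close> this rests on ln f = ln(f/i) + ln i with
    ln i \<le> c; otherwise \<open>Dr\<close> is infinite and the right-hand side is infinite
    wherever \<open>f\<close> is positive.\<close>
  have pw: "ennreal (f x * max 0 (ln (f x)))
      \<le> ennreal (f x) * (Dr f C x * indicator (fsupp f) x) + ennreal c * ennreal (f x)" for x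
  proof (cases "f x = 0")
    case False
    then have fx: "f x > 0" using f0[of x] by simp
    then have x: "x \<in> fsupp f" by (simp add: fsupp_def)
    define i where "i = Inf (f ` C x)"
    have bdd: "bdd_below (f ` C x)" using f0 by (intro bdd_belowI[of _ 0]) auto
    show ?thesis
    proof (cases "i \<le> 0")
      case True
      then have "Dr f C x = \<infinity>" by (simp add: Dr_def i_def)
      then show ?thesis using fx x by (simp add: ennreal_mult_top)
    next
      case False
      have Cm [measurable]: "C x \<in> sets lebesgue"
        using bspec[OF C x] by (auto simp: closed_cube_def)
      \<comment> \<open>The infimum times the volume of the cube is at most the total mass
        1.\<close>
      have "ennreal i * ennreal (r ^ CARD('n)) = (\<integral>\<^sup>+z. ennreal i * indicator (C x) z \<partial>lebesgue)"
        using emeasure_closed_cube[of r "C x"] bspec[OF C x] r by (simp add: nn_integral_cmult_indicator)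
      also have "\<dots> \<le> (\<integral>\<^sup>+z. ennreal (f z) \<partial>lebesgue)"
        using bdd by (intro nn_integral_mono)
          (auto simp: indicator_def i_def intro!: ennreal_leI cInf_lower)
      finally have "ennreal (i * r ^ CARD('n)) \<le> ennreal 1"
        using False r by (simp add: f1 ennreal_mult')
      then have "i * r ^ CARD('n) \<le> 1" by (subst (asm) ennreal_le_iff) auto
      then have "ln (i * r ^ CARD('n)) \<le> 0" using False r by (subst ln_le_zero_iff) auto
      then have li: "ln i \<le> c" using False r unfolding c_def by (simp add: ln_mult)
      \<comment> \<open>The cube contains \<open>x\<close>, so ln(f/i) is nonnegative. This settles
        the case where the maximum below is 0.\<close>
      have "i \<le> f x" unfolding i_def using bspec[OF C x] bdd by (intro cInf_lower) auto
      then have pos: "ln (f x / i) \<ge> 0" using False by simp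
      have "max 0 (ln (f x)) \<le> ln (f x / i) + c"
        using li pos fx False by (auto simp: ln_div c_def)
      from mult_left_mono[OF this f0[of x]]
      have "f x * max 0 (ln (f x)) \<le> f x * ln (f x / i) + c * f x"
        by (simp only: distrib_left mult.commute[of c])
      then have "ennreal (f x * max 0 (ln (f x))) \<le> ennreal (f x * ln (f x / i) + c * f x)"
        by (rule ennreal_leI)
      also have "\<dots> = ennreal (f x) * ennreal (ln (f x / i)) + ennreal c * ennreal (f x)"
        using pos fx by (simp add: ennreal_mult c_def)
      also have "ennreal (ln (f x / i)) = Dr f C x * indicator (fsupp f) x"
        using False x by (simp add: Dr_def i_def)
      finally show ?thesis .
    qed
  qed simp
  have "(\<integral>\<^sup>+x. ennreal (f x * max 0 (ln (f x))) \<partial>lebesgue)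
      \<le> (\<integral>\<^sup>+x. ennreal (f x) * (Dr f C x * indicator (fsupp f) x) + ennreal c * ennreal (f x) \<partial>lebesgue)"
    by (rule nn_integral_mono) (rule pw)
  also have "\<dots> = (\<integral>\<^sup>+x. ennreal (f x) * (Dr f C x * indicator (fsupp f) x) \<partial>lebesgue) + ennreal c"
    by (subst nn_integral_add) (auto simp: nn_integral_cmult f1)
  also have "(\<integral>\<^sup>+x. ennreal (f x) * (Dr f C x * indicator (fsupp f) x) \<partial>lebesgue)
      = (\<integral>\<^sup>+ y \<in> fsupp f. Dr f C y \<partial>Fmeas f)"
    unfolding Fmeas_def by (rule nn_integral_density[symmetric]) auto
  finally show ?thesis using Di by (auto simp: top_unique less_top[symmetric])
qed

text \<open>Mixing a little of \<open>std_gauss\<close> into \<open>g\<close> dominates the integrand uniformly in \<open>g\<close>, which makes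
  the divergence continuous under almost everywhere convergence.\<close>
lemma relative_entropy_ae_closure_GMM:
  fixes f :: "real^'n \<Rightarrow> real"
  defines "H g \<equiv> \<lambda>d. (\<integral>\<^sup>+x. ennreal (f x * ln (f x / ((1 - d) * g x + d * std_gauss x))) \<partial>lebesgue)"
  assumes f: "is_density f"
    and ent: "(\<integral>\<^sup>+x. ennreal (f x * max 0 (ln (f x))) \<partial>lebesgue) < \<infinity>"
    and mom: "(\<integral>\<^sup>+ x. ennreal ((norm x)\<^sup>2 * f x) \<partial>lebesgue) < \<infinity>"
    and d: "0 < d" "d < 1"
    and ge: "\<And>w. w \<in> GMM \<Longrightarrow> c \<le> H w d"
    and g: "g \<in> ae_closure GMM"
  shows "c \<le> H g d"
proof -
  have [measurable]: "f \<in> borel_measurable lebesgue" and f0: "\<And>x. f x \<ge> 0"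
    and f1: "(\<integral>\<^sup>+x. ennreal (f x) \<partial>lebesgue) = 1"
    using f by (auto simp: is_density_def)
  have [measurable]: "norm \<in> borel_measurable (lebesgue :: (real^'n) measure)"
    "(std_gauss :: real^'n \<Rightarrow> real) \<in> borel_measurable lebesgue"
    by (rule borel_measurable_lebesgueI; simp)+
  define a where "a = \<bar>ln d\<bar> + \<bar>ln (sqrt ((2 * pi) ^ CARD('n)))\<bar>"
  \<comment> \<open>Comes from bounding the denominator below by \<open>d * std_gauss x\<close>,
    whose negative logarithm is |x|^2 / 2 plus constants bounded by \<open>a\<close>. No value of
    \<open>g\<close> enters.\<close>
  define D where "D x = ennreal (f x * max 0 (ln (f x))) + ennreal a * ennreal (f x) + ennreal ((norm x)\<^sup>2 * f x)" for x
  have [measurable]: "D \<in> borel_measurable lebesgue" unfolding D_def[abs_def] by measurable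
  have Dfin: "(\<integral>\<^sup>+x. D x \<partial>lebesgue) < \<infinity>"
    unfolding D_def using ent mom by (simp add: nn_integral_add nn_integral_cmult f1)
  have dom: "ennreal (f x * ln (f x / ((1 - d) * y + d * std_gauss x))) \<le> D x" if "y \<ge> 0" for x y
  proof (cases "f x = 0")
    case False
    then have fx: "f x > 0" using f0[of x] by simp
    let ?s = "sqrt ((2 * pi) ^ CARD('n))"
    have "ln (d * std_gauss x) = ln d - (norm x)\<^sup>2 / 2 - ln ?s"
      using d by (simp add: std_gauss_def ln_mult ln_div)
    moreover have "ln (d * std_gauss x) \<le> ln ((1 - d) * y + d * std_gauss x)"
      using d that std_gauss_pos[of x] by (intro ln_mono) (auto intro!: mult_pos_pos add_nonneg_pos)
    moreover have "ln (f x / ((1 - d) * y + d * std_gauss x)) = ln (f x) - ln ((1 - d) * y + d * std_gauss x)"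
    proof (rule ln_divide_pos)
      show "(1 - d) * y + d * std_gauss x > 0"
        using d that std_gauss_pos[of x] by (intro add_nonneg_pos) auto
    qed (use fx in simp)
    ultimately have "ln (f x / ((1 - d) * y + d * std_gauss x)) \<le> max 0 (ln (f x)) + a + (norm x)\<^sup>2"
      unfolding a_def using zero_le_power2[of "norm x"] by linarith
    then have "f x * ln (f x / ((1 - d) * y + d * std_gauss x)) \<le> f x * (max 0 (ln (f x)) + a + (norm x)\<^sup>2)"
      using f0 by (rule mult_left_mono)
    then have "ennreal (f x * ln (f x / ((1 - d) * y + d * std_gauss x)))
      \<le> ennreal (f x * max 0 (ln (f x)) + a * f x + (norm x)\<^sup>2 * f x)"
      by (intro ennreal_leI) (simp add: algebra_simps)
    also have "\<dots> = D x"
    proof -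
      have "a \<ge> 0" by (simp add: a_def)
      then show ?thesis
        using f0[of x] ennreal_mult[of a "f x"] by (simp add: D_def)
    qed
    finally show ?thesis .
  qed simp
  \<comment> \<open>Measurability and nonnegativity are carried through the induction because
    dominated convergence needs them for the approximants \<open>u i\<close>.\<close>
  from g have "g \<in> borel_measurable lebesgue \<and> (\<forall>x. g x \<ge> 0) \<and> c \<le> H g d"
  proof (induction rule: ae_closure.induct)
    case (base g)
    then show ?case
      by (intro conjI allI borel_measurable_lebesgueI borel_measurable_GMM less_imp_le[OF GMM_pos] ge)
  next
    case (lim u g)
    have [measurable]: "u i \<in> borel_measurable lebesgue" for i using lim by blast
    have [measurable]: "g \<in> borel_measurable lebesgue" by fact
    have "(\<lambda>i. H (u i) d) \<longlonglongrightarrow> H g d"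
      unfolding H_def
    proof (rule nn_integral_dominated_convergence[where w = D])
      show "AE x in lebesgue. (\<lambda>i. ennreal (f x * ln (f x / ((1 - d) * u i x + d * std_gauss x))))
          \<longlonglongrightarrow> ennreal (f x * ln (f x / ((1 - d) * g x + d * std_gauss x)))"
        using lim(4)
      proof (rule AE_mp, intro AE_I2 impI tendsto_ennrealI)
        fix x assume ux: "(\<lambda>i. u i x) \<longlonglongrightarrow> g x"
        have den: "(1 - d) * g x + d * std_gauss x > 0"
          using d lim(3)[of x] std_gauss_pos[of x] by (intro add_nonneg_pos) auto
        show "(\<lambda>i. f x * ln (f x / ((1 - d) * u i x + d * std_gauss x)))
          \<longlonglongrightarrow> f x * ln (f x / ((1 - d) * g x + d * std_gauss x))"
        proof (cases "f x = 0")
          case False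
          then show ?thesis using den by (intro tendsto_intros ux) auto
        qed simp
      qed
      show "AE x in lebesgue. ennreal (f x * ln (f x / ((1 - d) * u i x + d * std_gauss x))) \<le> D x" for i
        using lim by (intro AE_I2 dom) auto
    qed (use Dfin in \<open>auto simp: less_top\<close>)
    then have "c \<le> H g d"
      using lim by (intro LIMSEQ_le_const) auto
    with lim show ?case by auto
  qed
  then show ?thesis by simp
qed

text \<open>By contradiction: if \<open>?H w \<ge> e\<close> for every mixture \<open>w\<close>, the
  bound would pass to the limit \<open>f\<close>, yet \<open>?H f\<close> is at most e / 2. A
  mixture \<open>w\<close> with small \<open>?H w\<close> yields the mixture \<open>?g\<close>,
  whose divergence is at most \<open>?H w\<close>.\<close>

lemma INF_KL_GMM_le_0:
  fixes f :: "real^'n \<Rightarrow> real"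
  assumes f: "is_density f"
    and ent: "(\<integral>\<^sup>+x. ennreal (f x * max 0 (ln (f x))) \<partial>lebesgue) < \<infinity>"
    and mom: "(\<integral>\<^sup>+ x. ennreal ((norm x)\<^sup>2 * f x) \<partial>lebesgue) < \<infinity>"
  shows "(INF g\<in>GMM. KL f g) \<le> 0"
proof (rule ereal_le_epsilon2)
  fix e :: real assume e: "e > 0"
  have f0: "\<And>x. f x \<ge> 0" and [measurable]: "f \<in> borel_measurable lebesgue"
    and f1: "(\<integral>\<^sup>+x. ennreal (f x) \<partial>lebesgue) = 1"
    using f by (auto simp: is_density_def)
  \<comment> \<open>Chosen so that -ln(1 - d) = e / 2, which bounds ln(f / ((1 - d) f + d N))
    wherever \<open>f\<close> is positive, N being \<open>std_gauss\<close>.\<close>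
  define d where "d = 1 - exp (- (e / 2))"
  have d: "0 < d" "d < 1" and ld: "ln (1 - d) = - (e / 2)" using e by (auto simp: d_def)
  let ?H = "\<lambda>g. (\<integral>\<^sup>+x. ennreal (f x * ln (f x / ((1 - d) * g x + d * std_gauss x))) \<partial>lebesgue)"
  have "?H f \<le> (\<integral>\<^sup>+x. ennreal (e / 2) * ennreal (f x) \<partial>lebesgue)"
  proof (rule nn_integral_mono)
    fix x
    have "f x * ln (f x / ((1 - d) * f x + d * std_gauss x)) \<le> e / 2 * f x"
    proof (cases "f x = 0")
      case False
      then have fx: "f x > 0" using f0[of x] by simp
      let ?den = "(1 - d) * f x + d * std_gauss x"
      have "(1 - d) * f x > 0" using d fx by simp
      moreover have "(1 - d) * f x \<le> ?den" using d std_gauss_pos[of x] by simp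
      ultimately have "ln ((1 - d) * f x) \<le> ln ?den" "?den > 0" by (auto intro: ln_mono)
      then have "ln (f x / ?den) \<le> e / 2" using fx d ld by (simp add: ln_div ln_mult)
      then have "f x * ln (f x / ?den) \<le> f x * (e / 2)" using f0 by (rule mult_left_mono)
      then show ?thesis by (simp add: mult.commute)
    qed simp
    then show "ennreal (f x * ln (f x / ((1 - d) * f x + d * std_gauss x))) \<le> ennreal (e / 2) * ennreal (f x)"
      using e f0[of x] by (subst ennreal_mult[symmetric]) (auto intro: ennreal_leI)
  qed
  also have "\<dots> = ennreal (e / 2)" by (simp add: nn_integral_cmult f1)
  also have "\<dots> < ennreal e" using e by (simp add: ennreal_less_iff)
  finally have "\<not> ennreal e \<le> ?H f" by (simp add: not_le)
  then obtain w where w: "w \<in> GMM" "?H w < ennreal e"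
    using relative_entropy_ae_closure_GMM[OF f ent mom d _ density_in_ae_closure_GMM[OF f], of "ennreal e"]
    by (meson not_le)
  let ?g = "\<lambda>x. (1 - d) * w x + d * std_gauss x"
  have sg: "std_gauss = (gauss 0 (mat 1) :: real^'n \<Rightarrow> real)"
    using gauss_mat[of 1 "0 :: real^'n"] by auto
  have g: "?g \<in> GMM"
    unfolding sg using w(1) d by (intro GMM_mix_gauss pos_def_mat_mat) auto
  \<comment> \<open>\<open>?H w\<close> is the positive part of the divergence from
    \<open>?g\<close>; subtracting the negative part only decreases it.\<close>
  have "KL f ?g \<le> enn2ereal (?H w)"
    unfolding KL_pos_part[OF GMM_pos[OF g]]
    by (intro ereal_diff_le_self enn2ereal_nonneg)
  also have "\<dots> \<le> enn2ereal (ennreal e)"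
    using w(2) by (simp add: less_eq_ennreal.rep_eq[symmetric])
  also have "\<dots> = 0 + ereal e" using e by (simp add: enn2ereal_ennreal)
  finally show "(INF g\<in>GMM. KL f g) \<le> 0 + ereal e"
    using g by (intro INF_lower2)
qed

theorem mainTheorem10:
  fixes f :: "real^'n \<Rightarrow> real"
  assumes "FSSA f"
  shows "(INF g\<in>GMM. KL f g) = 0 \<longleftrightarrow>
         (\<integral>\<^sup>+ x. ennreal ((norm x)\<^sup>2 * f x) \<partial>lebesgue) < \<infinity>"
proof
  have f: "is_density f" using assms by (simp add: FSSA_def)
  {
    assume "(INF g\<in>GMM. KL f g) = 0"
    then have "(INF g\<in>GMM. KL f g) < 1" by simp
    then obtain g where "g \<in> GMM" "KL f g < 1" by (auto simp: INF_less_iff)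
    then show "(\<integral>\<^sup>+ x. ennreal ((norm x)\<^sup>2 * f x) \<partial>lebesgue) < \<infinity>"
      using second_moment_finite_if_KL_finite[OF f] by force
  }
  assume "(\<integral>\<^sup>+ x. ennreal ((norm x)\<^sup>2 * f x) \<partial>lebesgue) < \<infinity>"
  then have "(INF g\<in>GMM. KL f g) \<le> 0"
    by (rule INF_KL_GMM_le_0[OF f FSSA_entropy_finite[OF assms]])
  moreover have "(INF g\<in>GMM. KL f g) \<ge> 0"
    by (rule INF_greatest) (rule KL_GMM_nonneg[OF f])
  ultimately show "(INF g\<in>GMM. KL f g) = 0" by simp
qed

end
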